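(* The automorphism group of a coclosed $\mathrm{G}_2$-structure on a compact manifold need not be abelian: there exist a compact 7-manifold $M$ and a coclosed $\mathrm{G}_2$-structure on $M$, given by a closed 4-form $\psi\in\Omega^4_+(M)$, such that the group $\mathrm{Diff}(M)_\psi=\{f\in\mathrm{Diff}(M)\mid f^*\psi=\psi\}$ is not abelian.
   Context: A $\mathrm{G}_2$-structure on a 7-manifold $M$ is a 3-form $\varphi\in\Omega^3(M)$ such that at each point $p$ there is a basis $\{\eta^1,\dots,\eta^7\}$ of $T_p^*M$ with $\varphi_p=\eta^{127}+\eta^{347}+\eta^{567}+\eta^{135}-\eta^{236}-\eta^{146}-\eta^{245}$, where $\eta^{ijk}=\eta^i\wedge\eta^j\wedge\eta^k$. It determines a Riemannian metric $g_\varphi$ and a volume form $\mathrm{vol}_\varphi$ through $6g_\varphi(X,Y)\mathrm{vol}_\varphi=\iota_X\varphi\wedge\iota_Y\varphi\wedge\varphi$, hence a Hodge star $*_\varphi$. $\Omega^4_+(M)$ denotes the set of 4-forms on $M$ which at each point are of the form $*_\varphi\varphi$ for a $\mathrm{G}_2$-structure $\varphi$ on the tangent space. The $\mathrm{G}_2$-structure is coclosed if $\psi=*_\varphi\varphi$ satisfies $\mathrm{d}\psi=0$. $\mathrm{Diff}(M)$ is the group of diffeomorphisms of $M$. *)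

theory Defs
  imports "HOL-Analysis.Analysis" "HOL-Combinatorics.Permutations" "HOL-Algebra.Bij"
begin

section \<open>Exterior algebra of a Euclidean space\<close>

text \<open>
  A \<open>k\<close>-form on \<open>'v\<close> takes its arguments as a sequence \<open>v :: nat \<Rightarrow> 'v\<close>, of which only
  \<open>v 0, \<dots>, v (k - 1)\<close> matter; in this way forms of all degrees live in one type.
\<close>

type_synonym 'v form = "(nat \<Rightarrow> 'v) \<Rightarrow> real"

definition alternating_form :: "nat \<Rightarrow> ('v::euclidean_space) form \<Rightarrow> bool" where
  "alternating_form k \<alpha> \<longleftrightarrow>
     (\<forall>v w. (\<forall>i<k. v i = w i) \<longrightarrow> \<alpha> v = \<alpha> w) \<and>
     (\<forall>v. \<forall>i<k. linear (\<lambda>x. \<alpha> (v(i := x)))) \<and>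
     (\<forall>v. \<forall>i<k. \<forall>j<k. i \<noteq> j \<and> v i = v j \<longrightarrow> \<alpha> v = 0)"

text \<open>
  The wedge product is normalised so that the wedge of covectors is their determinant:
  \<open>(\<eta> \<and> \<theta>) (x, y) = \<eta> x * \<theta> y - \<eta> y * \<theta> x\<close>.
\<close>

definition wedge :: "nat \<Rightarrow> nat \<Rightarrow> ('v::euclidean_space) form \<Rightarrow> 'v form \<Rightarrow> 'v form" where
  "wedge k l \<alpha> \<beta> = (\<lambda>v.
     (\<Sum>\<sigma> | \<sigma> permutes {..<k + l}.
        of_int (sign \<sigma>) * \<alpha> (\<lambda>i. v (\<sigma> i)) * \<beta> (\<lambda>i. v (\<sigma> (k + i)))) / (fact k * fact l))"

definition interior_product :: "'v \<Rightarrow> ('v::euclidean_space) form \<Rightarrow> 'v form" where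
  "interior_product x \<alpha> = (\<lambda>v. \<alpha> (case_nat x v))"

definition covector_form :: "('v::euclidean_space \<Rightarrow>\<^sub>L real) \<Rightarrow> 'v form" where
  "covector_form \<eta> = (\<lambda>v. blinfun_apply \<eta> (v 0))"

definition wedge3 :: "('v::euclidean_space \<Rightarrow>\<^sub>L real) \<Rightarrow> ('v \<Rightarrow>\<^sub>L real) \<Rightarrow> ('v \<Rightarrow>\<^sub>L real) \<Rightarrow> 'v form" where
  "wedge3 \<eta> \<theta> \<zeta> =
     wedge 2 1 (wedge 1 1 (covector_form \<eta>) (covector_form \<theta>)) (covector_form \<zeta>)"

definition inner_product :: "('v::euclidean_space \<Rightarrow> 'v \<Rightarrow> real) \<Rightarrow> bool" where
  "inner_product g \<longleftrightarrow>
     (\<forall>x. linear (g x)) \<and> (\<forall>x y. g x y = g y x) \<and> (\<forall>x. x \<noteq> 0 \<longrightarrow> g x x > 0)"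

definition orthonormal_frame :: "('v::euclidean_space \<Rightarrow> 'v \<Rightarrow> real) \<Rightarrow> (nat \<Rightarrow> 'v) \<Rightarrow> bool" where
  "orthonormal_frame g e \<longleftrightarrow>
     (\<forall>i<DIM('v). \<forall>j<DIM('v). g (e i) (e j) = (if i = j then 1 else 0))"

text \<open>Both orientations are allowed: an inner product has exactly two volume forms.\<close>

definition volume_form :: "('v::euclidean_space \<Rightarrow> 'v \<Rightarrow> real) \<Rightarrow> 'v form \<Rightarrow> bool" where
  "volume_form g vol \<longleftrightarrow>
     alternating_form DIM('v) vol \<and> (\<forall>e. orthonormal_frame g e \<longrightarrow> \<bar>vol e\<bar> = 1)"

text \<open>
  The inner product induced on \<open>k\<close>-forms, computed in an orthonormal frame \<open>e\<close>, on the choice of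
  which it does not depend. The sum runs over all \<open>k\<close>-tuples of indices, so that the factor
  \<open>1 / k!\<close> makes the \<open>k\<close>-fold wedges of the dual coframe orthonormal.
\<close>

definition form_inner :: "(nat \<Rightarrow> 'v::euclidean_space) \<Rightarrow> nat \<Rightarrow> 'v form \<Rightarrow> 'v form \<Rightarrow> real" where
  "form_inner e k \<alpha> \<beta> =
     (\<Sum>I \<in> {..<k} \<rightarrow>\<^sub>E {..<DIM('v)}. \<alpha> (\<lambda>i. e (I i)) * \<beta> (\<lambda>i. e (I i))) / fact k"

text \<open>
  \<open>\<gamma>\<close> is the Hodge dual of the \<open>k\<close>-form \<open>\<beta>\<close>: \<open>\<alpha> \<and> \<gamma> = \<langle>\<alpha>, \<beta>\<rangle> vol\<close> for all \<open>k\<close>-forms \<open>\<alpha>\<close>.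
\<close>

definition is_hodge_star ::
  "('v::euclidean_space \<Rightarrow> 'v \<Rightarrow> real) \<Rightarrow> 'v form \<Rightarrow> nat \<Rightarrow> 'v form \<Rightarrow> 'v form \<Rightarrow> bool" where
  "is_hodge_star g vol k \<beta> \<gamma> \<longleftrightarrow>
     alternating_form (DIM('v) - k) \<gamma> \<and>
     (\<exists>e. orthonormal_frame g e \<and>
        (\<forall>\<alpha>. alternating_form k \<alpha> \<longrightarrow>
           (\<forall>v. wedge k (DIM('v) - k) \<alpha> \<gamma> v = form_inner e k \<alpha> \<beta> * vol v)))"


section \<open>\<open>G\<^sub>2\<close>-structures on a vector space\<close>

definition g2_form :: "('v::euclidean_space) form \<Rightarrow> bool" where
  "g2_form \<phi> \<longleftrightarrow>
     (\<exists>\<eta> :: nat \<Rightarrow> ('v \<Rightarrow>\<^sub>L real).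
        inj_on \<eta> {1..7} \<and> independent (\<eta> ` {1..7}) \<and> span (\<eta> ` {1..7}) = UNIV \<and>
        \<phi> = (\<lambda>v. wedge3 (\<eta> 1) (\<eta> 2) (\<eta> 7) v + wedge3 (\<eta> 3) (\<eta> 4) (\<eta> 7) v
               + wedge3 (\<eta> 5) (\<eta> 6) (\<eta> 7) v + wedge3 (\<eta> 1) (\<eta> 3) (\<eta> 5) v
               - wedge3 (\<eta> 2) (\<eta> 3) (\<eta> 6) v - wedge3 (\<eta> 1) (\<eta> 4) (\<eta> 6) v
               - wedge3 (\<eta> 2) (\<eta> 4) (\<eta> 5) v))"

text \<open>
  The metric and volume form of a \<open>G\<^sub>2\<close>-form. The identity alone fixes the pair only up to
  \<open>(c g, vol / c)\<close>; it becomes unique because \<open>g\<close> is positive definite and \<open>vol\<close> is a volume form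
  of \<open>g\<close>.
\<close>

definition g2_metric_volume ::
  "('v::euclidean_space) form \<Rightarrow> ('v \<Rightarrow> 'v \<Rightarrow> real) \<Rightarrow> 'v form \<Rightarrow> bool" where
  "g2_metric_volume \<phi> g vol \<longleftrightarrow>
     inner_product g \<and> volume_form g vol \<and>
     (\<forall>x y v. 6 * g x y * vol v =
        wedge 4 3 (wedge 2 2 (interior_product x \<phi>) (interior_product y \<phi>)) \<phi> v)"

text \<open>\<open>\<psi> = *\<^sub>\<phi> \<phi>\<close>\<close>

definition is_g2_dual :: "('v::euclidean_space) form \<Rightarrow> 'v form \<Rightarrow> bool" where
  "is_g2_dual \<phi> \<psi> \<longleftrightarrow> (\<exists>g vol. g2_metric_volume \<phi> g vol \<and> is_hodge_star g vol 3 \<phi> \<psi>)"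


section \<open>Smooth manifolds\<close>

primrec Ck_on :: "nat \<Rightarrow> 'a set \<Rightarrow> ('a::euclidean_space \<Rightarrow> 'b::real_normed_vector) \<Rightarrow> bool" where
  "Ck_on 0 S f \<longleftrightarrow> continuous_on S f"
| "Ck_on (Suc k) S f \<longleftrightarrow>
     (\<forall>x\<in>S. f differentiable (at x)) \<and>
     (\<forall>v. Ck_on k S (\<lambda>x. frechet_derivative f (at x) v))"

text \<open>Only meaningful for open \<open>S\<close>, the only case in which it is used.\<close>

definition smooth_on :: "'a set \<Rightarrow> ('a::euclidean_space \<Rightarrow> 'b::real_normed_vector) \<Rightarrow> bool" where
  "smooth_on S f \<longleftrightarrow> (\<forall>k. Ck_on k S f)"

text \<open>A chart is a pair of its domain and its coordinate map, whose values off the domain are junk.\<close>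

type_synonym ('a, 'e) chart = "'a set \<times> ('a \<Rightarrow> 'e)"

abbreviation chart_dom :: "('a, 'e) chart \<Rightarrow> 'a set" where
  "chart_dom \<equiv> fst"

abbreviation chart_map :: "('a, 'e) chart \<Rightarrow> 'a \<Rightarrow> 'e" where
  "chart_map \<equiv> snd"

definition chart_image :: "('a, 'e) chart \<Rightarrow> 'e set" where
  "chart_image c = chart_map c ` chart_dom c"

definition chart_inv :: "('a, 'e) chart \<Rightarrow> 'e \<Rightarrow> 'a" where
  "chart_inv c = inv_into (chart_dom c) (chart_map c)"

definition is_chart :: "'a topology \<Rightarrow> ('a, 'e::euclidean_space) chart \<Rightarrow> bool" where
  "is_chart X c \<longleftrightarrow>
     openin X (chart_dom c) \<and> open (chart_image c) \<and>
     homeomorphic_map (subtopology X (chart_dom c)) (top_of_set (chart_image c)) (chart_map c)"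

definition smooth_atlas :: "'a topology \<Rightarrow> ('a, 'e::euclidean_space) chart set \<Rightarrow> bool" where
  "smooth_atlas X A \<longleftrightarrow>
     (\<forall>c\<in>A. is_chart X c) \<and> (\<Union>c\<in>A. chart_dom c) = topspace X \<and>
     (\<forall>c\<in>A. \<forall>d\<in>A. smooth_on (chart_map c ` (chart_dom c \<inter> chart_dom d))
                       (\<lambda>x. chart_map d (chart_inv c x)))"

text \<open>
  The dimension of the manifold is that of the model space \<open>'e\<close>. The atlas need not be maximal: it
  determines the smooth structure, and the notions below are the same for all atlases of one smooth
  structure.
\<close>

definition smooth_manifold :: "'a topology \<Rightarrow> ('a, 'e::euclidean_space) chart set \<Rightarrow> bool" where
  "smooth_manifold X A \<longleftrightarrow> Hausdorff_space X \<and> second_countable X \<and> smooth_atlas X A"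

definition smooth_map ::
  "'a topology \<Rightarrow> ('a, 'e::euclidean_space) chart set \<Rightarrow>
   'b topology \<Rightarrow> ('b, 'f::euclidean_space) chart set \<Rightarrow> ('a \<Rightarrow> 'b) \<Rightarrow> bool" where
  "smooth_map X A Y B f \<longleftrightarrow>
     continuous_map X Y f \<and>
     (\<forall>c\<in>A. \<forall>d\<in>B. smooth_on (chart_map c ` {p \<in> chart_dom c. f p \<in> chart_dom d})
                       (\<lambda>x. chart_map d (f (chart_inv c x))))"

text \<open>
  At each point a preferred chart is chosen, and the tangent space at \<open>p\<close> is the model space \<open>'e\<close>, a
  vector \<open>v :: 'e\<close> standing for the tangent vector with coordinates \<open>v\<close> in the preferred chart at
  \<open>p\<close>. Hence the tangent map of \<open>f\<close> at \<open>p\<close> is the derivative of \<open>f\<close> in the preferred charts at \<open>p\<close>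
  and \<open>f p\<close>, and a field of forms is a function \<open>'a \<Rightarrow> 'e form\<close>.
\<close>

definition chart_at :: "('a, 'e) chart set \<Rightarrow> 'a \<Rightarrow> ('a, 'e) chart" where
  "chart_at A p = (SOME c. c \<in> A \<and> p \<in> chart_dom c)"

definition tangent_map ::
  "('a, 'e::euclidean_space) chart set \<Rightarrow> ('b, 'f::euclidean_space) chart set \<Rightarrow>
   ('a \<Rightarrow> 'b) \<Rightarrow> 'a \<Rightarrow> 'e \<Rightarrow> 'f" where
  "tangent_map A B f p =
     frechet_derivative (\<lambda>x. chart_map (chart_at B (f p)) (f (chart_inv (chart_at A p) x)))
       (at (chart_map (chart_at A p) p))"


section \<open>Differential forms\<close>

text \<open>
  The coordinate expression of \<open>\<omega>\<close> in the chart \<open>c\<close>, i.e. the pullback of \<open>\<omega>\<close> along the inverse of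
  \<open>c\<close>. The derivative converts coordinates in \<open>c\<close> to coordinates in the preferred chart at the point.
\<close>

definition form_in_chart ::
  "('a, 'e::euclidean_space) chart set \<Rightarrow> ('a \<Rightarrow> 'e form) \<Rightarrow> ('a, 'e) chart \<Rightarrow> 'e \<Rightarrow> 'e form" where
  "form_in_chart A \<omega> c x =
     (let p = chart_inv c x;
          D = frechet_derivative (\<lambda>y. chart_map (chart_at A p) (chart_inv c y)) (at x)
      in (\<lambda>v. \<omega> p (\<lambda>i. D (v i))))"

definition differential_form ::
  "'a topology \<Rightarrow> ('a, 'e::euclidean_space) chart set \<Rightarrow> nat \<Rightarrow> ('a \<Rightarrow> 'e form) \<Rightarrow> bool" where
  "differential_form X A k \<omega> \<longleftrightarrow>
     (\<forall>p\<in>topspace X. alternating_form k (\<omega> p)) \<and>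
     (\<forall>c\<in>A. \<forall>v. smooth_on (chart_image c) (\<lambda>x. form_in_chart A \<omega> c x v))"

text \<open>
  The exterior derivative of a \<open>k\<close>-form on an open subset of \<open>'e\<close>:
  \<open>(d \<beta>)\<^sub>x (v 0, \<dots>, v k) = (\<Sum>i\<le>k. (-1)\<^sup>i * D (\<beta> (v 0, \<dots>, v (i - 1), v (i + 1), \<dots>, v k)) x (v i))\<close>
  for constant vector fields \<open>v i\<close>.
\<close>

definition ext_deriv_local :: "nat \<Rightarrow> ('e::euclidean_space \<Rightarrow> 'e form) \<Rightarrow> 'e \<Rightarrow> 'e form" where
  "ext_deriv_local k \<beta> x = (\<lambda>v.
     \<Sum>i\<le>k. (- 1) ^ i *
       frechet_derivative (\<lambda>y. \<beta> y (\<lambda>j. if j < i then v j else v (Suc j))) (at x) (v i))"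

text \<open>
  The exterior derivative on a manifold, computed at \<open>p\<close> in the preferred chart there, in which
  tangent vectors at \<open>p\<close> already have their coordinates.
\<close>

definition ext_deriv ::
  "('a, 'e::euclidean_space) chart set \<Rightarrow> nat \<Rightarrow> ('a \<Rightarrow> 'e form) \<Rightarrow> 'a \<Rightarrow> 'e form" where
  "ext_deriv A k \<omega> p =
     ext_deriv_local k (form_in_chart A \<omega> (chart_at A p)) (chart_map (chart_at A p) p)"

definition closed_form ::
  "'a topology \<Rightarrow> ('a, 'e::euclidean_space) chart set \<Rightarrow> nat \<Rightarrow> ('a \<Rightarrow> 'e form) \<Rightarrow> bool" where
  "closed_form X A k \<omega> \<longleftrightarrow> (\<forall>p\<in>topspace X. \<forall>v. ext_deriv A k \<omega> p v = 0)"

definition pullback_form ::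
  "('a, 'e::euclidean_space) chart set \<Rightarrow> ('b, 'f::euclidean_space) chart set \<Rightarrow>
   ('a \<Rightarrow> 'b) \<Rightarrow> ('b \<Rightarrow> 'f form) \<Rightarrow> 'a \<Rightarrow> 'e form" where
  "pullback_form A B f \<omega> p = (\<lambda>v. \<omega> (f p) (\<lambda>i. tangent_map A B f p (v i)))"


section \<open>\<open>G\<^sub>2\<close>-structures on manifolds\<close>

definition g2_structure ::
  "'a topology \<Rightarrow> ('a, 'e::euclidean_space) chart set \<Rightarrow> ('a \<Rightarrow> 'e form) \<Rightarrow> bool" where
  "g2_structure X A \<phi> \<longleftrightarrow> differential_form X A 3 \<phi> \<and> (\<forall>p\<in>topspace X. g2_form (\<phi> p))"

definition Omega4_plus ::
  "'a topology \<Rightarrow> ('a, 'e::euclidean_space) chart set \<Rightarrow> ('a \<Rightarrow> 'e form) set" where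
  "Omega4_plus X A =
     {\<psi>. differential_form X A 4 \<psi> \<and>
          (\<forall>p\<in>topspace X. \<exists>\<phi>. g2_form \<phi> \<and> is_g2_dual \<phi> (\<psi> p))}"

text \<open>
  \<open>\<phi>\<close> is a coclosed \<open>G\<^sub>2\<close>-structure with dual 4-form \<open>\<psi> = *\<^sub>\<phi> \<phi>\<close>. Since \<open>\<phi>\<close> and \<open>- \<phi>\<close> have the same
  dual, \<open>\<psi>\<close> determines \<open>\<phi>\<close> only up to an orientation.
\<close>

definition coclosed_g2_structure ::
  "'a topology \<Rightarrow> ('a, 'e::euclidean_space) chart set \<Rightarrow>
   ('a \<Rightarrow> 'e form) \<Rightarrow> ('a \<Rightarrow> 'e form) \<Rightarrow> bool" where
  "coclosed_g2_structure X A \<phi> \<psi> \<longleftrightarrow>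
     g2_structure X A \<phi> \<and> \<psi> \<in> Omega4_plus X A \<and>
     (\<forall>p\<in>topspace X. is_g2_dual (\<phi> p) (\<psi> p)) \<and> closed_form X A 4 \<psi>"

definition Diff :: "'a topology \<Rightarrow> ('a, 'e::euclidean_space) chart set \<Rightarrow> ('a \<Rightarrow> 'a) monoid" where
  "Diff X A = BijGroup (topspace X)
     \<lparr>carrier := {f \<in> Bij (topspace X).
        smooth_map X A X A f \<and> smooth_map X A X A (inv_into (topspace X) f)}\<rparr>"

definition Diff_stabilizer ::
  "'a topology \<Rightarrow> ('a, 'e::euclidean_space) chart set \<Rightarrow> ('a \<Rightarrow> 'e form) \<Rightarrow> ('a \<Rightarrow> 'a) monoid" where
  "Diff_stabilizer X A \<psi> = Diff X A
     \<lparr>carrier := {f \<in> carrier (Diff X A). \<forall>p\<in>topspace X. pullback_form A A f \<psi> p = \<psi> p}\<rparr>"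

end

theory Submission
  imports Defs
begin

text \<open>
  The example is the flat torus \<open>T\<^sup>7\<close>, the product of seven unit circles in \<open>\<complex>\<^sup>7\<close>, with the
  \<open>G\<^sub>2\<close>-structure that has constant coefficients in the angle coordinates. Its dual 4-form \<open>\<psi>\<close> has
  constant coefficients as well, so it is closed. Every translation of the torus preserves \<open>\<psi>\<close>,
  because its differential is the identity; so does the inversion \<open>x \<mapsto> - x\<close>, because its
  differential is \<open>- id\<close> and \<open>\<psi>\<close> has even degree (the inversion reverses \<open>\<phi>\<close>, which \<open>\<psi>\<close> does not
  see). Conjugating a translation by the inversion inverts it, so the two do not commute unless the
  translation has order at most two.
  
  Two things need work. The first is linear algebra: the standard 3-form on a Euclidean space of
  dimension 7 has the Euclidean metric, and its Hodge dual is the expected 4-form. All forms involved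
  are integer combinations of wedges of an orthonormal coframe. Wedging such combinations amounts to
  concatenating index lists (\<open>wedge_wedge_comb\<close>), and in top degree a wedge is the volume form up to
  the sign found by sorting its list of indices (\<open>flat_wedge_top_degree\<close>). By multilinearity the
  metric identity and the Hodge identity thereby become finite tables of integers, which rewriting
  verifies (\<open>g2_metric_coeffs\<close>, \<open>g2_hodge_coeffs\<close>).
  
  The second is the smooth structure. Charts are inverse branches of the covering
  \<open>x \<mapsto> (exp (i x\<^sub>1), \<dots>, exp (i x\<^sub>n))\<close>. A self-map of the torus that lifts to \<open>x \<mapsto> s x + b\<close>
  is given in any two charts by a function that differs from \<open>s x + b\<close> by a locally constant vector,
  since the ambiguity is a lattice vector (\<open>lifted_affine_has_derivative\<close>). Applied to the identity,
  this gives the transition functions, and with them the coordinate expressions of constant forms;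
  applied to translations and to the inversion, it gives their smoothness and tangent maps.
\<close>

section \<open>Antisymmetrisation and the wedge product\<close>

definition multilinear_form :: "nat \<Rightarrow> ('v::euclidean_space) form \<Rightarrow> bool" where
  "multilinear_form k \<alpha> \<longleftrightarrow>
     (\<forall>v w. (\<forall>i<k. v i = w i) \<longrightarrow> \<alpha> v = \<alpha> w) \<and>
     (\<forall>v. \<forall>i<k. linear (\<lambda>x. \<alpha> (v(i := x))))"

lemma multilinear_formI:
  assumes "\<And>v w. (\<And>i. i < k \<Longrightarrow> v i = w i) \<Longrightarrow> \<alpha> v = \<alpha> w"
    and "\<And>v i. i < k \<Longrightarrow> linear (\<lambda>x. \<alpha> (v(i := x)))"
  shows "multilinear_form k \<alpha>"
  using assms unfolding multilinear_form_def by blast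

lemma multilinear_form_cong:
  "multilinear_form k \<alpha> \<Longrightarrow> (\<And>i. i < k \<Longrightarrow> v i = w i) \<Longrightarrow> \<alpha> v = \<alpha> w"
  unfolding multilinear_form_def by blast

lemma multilinear_form_linear:
  "multilinear_form k \<alpha> \<Longrightarrow> i < k \<Longrightarrow> linear (\<lambda>x. \<alpha> (v(i := x)))"
  unfolding multilinear_form_def by blast

lemma alternating_form_iff:
  "alternating_form k \<alpha> \<longleftrightarrow>
     multilinear_form k \<alpha> \<and> (\<forall>v. \<forall>i<k. \<forall>j<k. i \<noteq> j \<and> v i = v j \<longrightarrow> \<alpha> v = 0)"
  unfolding alternating_form_def multilinear_form_def by blast

lemma alternating_form_sum:
  assumes "\<And>j. j \<in> J \<Longrightarrow> alternating_form k (\<alpha> j)"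
  shows "alternating_form k (\<lambda>v. \<Sum>j\<in>J. c j * \<alpha> j v)"
proof -
  have "(\<Sum>j\<in>J. c j * \<alpha> j v) = (\<Sum>j\<in>J. c j * \<alpha> j w)" if "\<And>i. i < k \<Longrightarrow> v i = w i" for v w
    using assms that by (intro sum.cong refl arg_cong2[of _ _ _ _ "(*)"])
      (auto simp: alternating_form_iff multilinear_form_def)
  moreover have "linear (\<lambda>x. \<Sum>j\<in>J. c j * \<alpha> j (v(i := x)))" if "i < k" for v i
    using assms that unfolding alternating_form_def
    by (intro linear_compose_sum ballI linear_compose_scale_right[where 'b=real, simplified]) auto
  moreover have "(\<Sum>j\<in>J. c j * \<alpha> j v) = 0" if "i < k" "j < k" "i \<noteq> j" "v i = v j" for v i j
    using assms that unfolding alternating_form_def by (intro sum.neutral) auto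
  ultimately show ?thesis
    unfolding alternating_form_def by blast
qed

text \<open>
  The antisymmetrisation without the factor \<open>1 / n!\<close>. The wedge product is the antisymmetrisation
  of a tensor product (\<open>wedge_eq_alt_sum\<close>), and associativity of the wedge product comes down to the
  fact that antisymmetrising a factor first changes the result only by a factorial.
\<close>

definition alt_sum :: "nat \<Rightarrow> 'v form \<Rightarrow> 'v form" where
  "alt_sum n \<alpha> = (\<lambda>v. \<Sum>\<sigma> | \<sigma> permutes {..<n}. of_int (sign \<sigma>) * \<alpha> (\<lambda>i. v (\<sigma> i)))"

lemma alt_sum_sum: "alt_sum n (\<lambda>u. \<Sum>j\<in>J. c j * \<alpha> j u) v = (\<Sum>j\<in>J. c j * alt_sum n (\<alpha> j) v)"
proof -
  have "alt_sum n (\<lambda>u. \<Sum>j\<in>J. c j * \<alpha> j u) v =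
      (\<Sum>\<sigma> | \<sigma> permutes {..<n}. \<Sum>j\<in>J. c j * (of_int (sign \<sigma>) * \<alpha> j (\<lambda>i. v (\<sigma> i))))"
    by (simp add: alt_sum_def sum_distrib_left mult_ac)
  also have "\<dots> = (\<Sum>j\<in>J. c j * alt_sum n (\<alpha> j) v)"
    by (subst sum.swap) (simp add: alt_sum_def sum_distrib_left)
  finally show ?thesis .
qed

lemma alt_sum_permute:
  assumes "\<pi> permutes {..<n}"
  shows "alt_sum n (\<lambda>u. \<alpha> (\<lambda>i. u (\<pi> i))) v = of_int (sign \<pi>) * alt_sum n \<alpha> v"
proof -
  have perm: "permutation \<pi>"
    using assms permutation_permutes by blast
  have "of_int (sign \<pi>) * alt_sum n \<alpha> v =
      (\<Sum>\<sigma> | \<sigma> permutes {..<n}. of_int (sign \<pi>) *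
         (of_int (sign (\<sigma> \<circ> \<pi>)) * \<alpha> (\<lambda>i. v (\<sigma> (\<pi> i)))))"
    unfolding alt_sum_def sum_distrib_left
    by (subst sum_permutations_compose_right[OF assms]) simp
  also have "\<dots> = alt_sum n (\<lambda>u. \<alpha> (\<lambda>i. u (\<pi> i))) v"
    unfolding alt_sum_def
  proof (intro sum.cong refl)
    fix \<sigma> assume "\<sigma> \<in> {\<sigma>. \<sigma> permutes {..<n}}"
    then have "permutation \<sigma>"
      using permutation_permutes by blast
    then show "of_int (sign \<pi>) * (of_int (sign (\<sigma> \<circ> \<pi>)) * \<alpha> (\<lambda>i. v (\<sigma> (\<pi> i)))) =
        of_int (sign \<sigma>) * \<alpha> (\<lambda>i. v (\<sigma> (\<pi> i)))"
      using sign_idempotent[of \<pi>] perm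
      by (simp add: sign_compose mult_ac flip: of_int_mult mult.assoc)
  qed
  finally show ?thesis by simp
qed

text \<open>
  If \<open>v i = v j\<close>, composing with the transposition of \<open>i\<close> and \<open>j\<close> permutes the summands and reverses
  all signs, so the sum is its own negative.
\<close>

lemma alternating_alt_sum:
  assumes "multilinear_form n \<alpha>"
  shows "alternating_form n (alt_sum n \<alpha>)"
  unfolding alternating_form_iff
proof (intro conjI multilinear_formI allI impI)
  fix v w :: "nat \<Rightarrow> 'a"
  assume vw: "\<And>i. i < n \<Longrightarrow> v i = w i"
  have "\<alpha> (\<lambda>i. v (\<sigma> i)) = \<alpha> (\<lambda>i. w (\<sigma> i))" if "\<sigma> permutes {..<n}" for \<sigma>
  proof (rule multilinear_form_cong[OF assms])
    fix i assume "i < n"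
    then have "\<sigma> i < n"
      using permutes_in_image[OF that, of i] by simp
    then show "v (\<sigma> i) = w (\<sigma> i)"
      by (rule vw)
  qed
  then show "alt_sum n \<alpha> v = alt_sum n \<alpha> w"
    unfolding alt_sum_def by (intro sum.cong) auto
next
  fix v :: "nat \<Rightarrow> 'a" and i assume i: "i < n"
  have "linear (\<lambda>x. \<alpha> (\<lambda>m. (v(i := x)) (\<sigma> m)))" if \<sigma>: "\<sigma> permutes {..<n}" for \<sigma>
  proof -
    have "inv_into UNIV \<sigma> i < n"
      using permutes_in_image[OF permutes_inv[OF \<sigma>], of i] i by simp
    moreover have "(\<lambda>m. (v(i := x)) (\<sigma> m)) = (\<lambda>m. v (\<sigma> m))(inv_into UNIV \<sigma> i := x)" for x
      using permutes_inverses[OF \<sigma>] by (auto simp: fun_eq_iff)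
    ultimately show ?thesis
      using multilinear_form_linear[OF assms, of "inv_into UNIV \<sigma> i"] by simp
  qed
  then show "linear (\<lambda>x. alt_sum n \<alpha> (v(i := x)))"
    unfolding alt_sum_def
    by (intro linear_compose_sum ballI linear_compose_scale_right[where 'b=real, simplified]) auto
next
  fix v :: "nat \<Rightarrow> 'a" and i j assume "i < n" "j < n" and ij: "i \<noteq> j \<and> v i = v j"
  then have t: "Transposition.transpose i j permutes {..<n}"
    by (intro permutes_swap_id) auto
  have vt: "v (Transposition.transpose i j m) = v m" for m
    using ij by (auto simp: Transposition.transpose_def)
  have "alt_sum n \<alpha> v =
      (\<Sum>\<sigma> | \<sigma> permutes {..<n}. of_int (sign (Transposition.transpose i j \<circ> \<sigma>)) * \<alpha> (\<lambda>m. v (\<sigma> m)))"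
    unfolding alt_sum_def
    by (subst setum_permutations_compose_left[OF t]) (simp add: vt)
  also have "\<dots> = (\<Sum>\<sigma> | \<sigma> permutes {..<n}. - (of_int (sign \<sigma>) * \<alpha> (\<lambda>m. v (\<sigma> m))))"
  proof (intro sum.cong refl)
    fix \<sigma> assume "\<sigma> \<in> {\<sigma>. \<sigma> permutes {..<n}}"
    then have "permutation \<sigma>"
      using permutation_permutes by blast
    then show "of_int (sign (Transposition.transpose i j \<circ> \<sigma>)) * \<alpha> (\<lambda>m. v (\<sigma> m)) =
        - (of_int (sign \<sigma>) * \<alpha> (\<lambda>m. v (\<sigma> m)))"
      using ij by (simp add: sign_compose permutation_swap_id sign_swap_id)
  qed
  also have "\<dots> = - alt_sum n \<alpha> v"
    by (simp add: alt_sum_def sum_negf)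
  finally show "alt_sum n \<alpha> v = 0" by simp
qed

text \<open>
  A permutation of the first \<open>k\<close> positions is one of all \<open>k + l\<close> positions, so by \<open>alt_sum_permute\<close> each
  of the \<open>k!\<close> inner summands contributes the same amount.
\<close>

lemma alt_sum_alt_sum_left:
  "alt_sum (k + l) (\<lambda>u. alt_sum k \<alpha> u * \<beta> (\<lambda>i. u (k + i))) v =
     fact k * alt_sum (k + l) (\<lambda>u. \<alpha> u * \<beta> (\<lambda>i. u (k + i))) v"
proof -
  let ?P = "{\<tau>. \<tau> permutes {..<k}}"
  have "alt_sum (k + l) (\<lambda>u. alt_sum k \<alpha> u * \<beta> (\<lambda>i. u (k + i))) v =
      alt_sum (k + l) (\<lambda>u. \<Sum>\<tau>\<in>?P. of_int (sign \<tau>) * (\<alpha> (\<lambda>i. u (\<tau> i)) * \<beta> (\<lambda>i. u (k + i)))) v"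
    by (simp add: alt_sum_def[of k] sum_distrib_right mult.assoc)
  also have "\<dots> = (\<Sum>\<tau>\<in>?P. of_int (sign \<tau>) *
      alt_sum (k + l) (\<lambda>u. \<alpha> (\<lambda>i. u (\<tau> i)) * \<beta> (\<lambda>i. u (k + i))) v)"
    by (rule alt_sum_sum)
  also have "\<dots> = (\<Sum>\<tau>\<in>?P. alt_sum (k + l) (\<lambda>u. \<alpha> u * \<beta> (\<lambda>i. u (k + i))) v)"
  proof (intro sum.cong refl)
    fix \<tau> assume "\<tau> \<in> ?P"
    then have "\<tau> permutes {..<k + l}" and high: "\<tau> (k + i) = k + i" for i
      using permutes_subset[of \<tau> "{..<k}" "{..<k + l}"] permutes_not_in[of \<tau> "{..<k}" "k + i"]
      by auto
    from alt_sum_permute[OF this(1), of "\<lambda>u. \<alpha> u * \<beta> (\<lambda>i. u (k + i))" v] high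
    show "of_int (sign \<tau>) * alt_sum (k + l) (\<lambda>u. \<alpha> (\<lambda>i. u (\<tau> i)) * \<beta> (\<lambda>i. u (k + i))) v =
        alt_sum (k + l) (\<lambda>u. \<alpha> u * \<beta> (\<lambda>i. u (k + i))) v"
      using sign_idempotent[of \<tau>] by (simp flip: of_int_mult mult.assoc)
  qed
  finally show ?thesis
    by (simp add: card_permutations[OF refl])
qed

text \<open>
  The same argument as for the left factor, with the permutation moved to the positions
  \<open>k, \<dots>, k + l - 1\<close>; it fixes the first \<open>k\<close> positions, which are all that \<open>\<alpha>\<close> sees.
\<close>

lemma alt_sum_alt_sum_right:
  assumes "\<And>u w. (\<And>i. i < k \<Longrightarrow> u i = w i) \<Longrightarrow> \<alpha> u = \<alpha> w"
  shows "alt_sum (k + l) (\<lambda>u. \<alpha> u * alt_sum l \<beta> (\<lambda>i. u (k + i))) v =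
     fact l * alt_sum (k + l) (\<lambda>u. \<alpha> u * \<beta> (\<lambda>i. u (k + i))) v"
proof -
  let ?P = "{\<tau>. \<tau> permutes {..<l}}"
  have "alt_sum (k + l) (\<lambda>u. \<alpha> u * alt_sum l \<beta> (\<lambda>i. u (k + i))) v =
      alt_sum (k + l) (\<lambda>u. \<Sum>\<tau>\<in>?P. of_int (sign \<tau>) * (\<alpha> u * \<beta> (\<lambda>i. u (k + \<tau> i)))) v"
    by (simp add: alt_sum_def[of l] sum_distrib_left mult_ac)
  also have "\<dots> = (\<Sum>\<tau>\<in>?P. of_int (sign \<tau>) *
      alt_sum (k + l) (\<lambda>u. \<alpha> u * \<beta> (\<lambda>i. u (k + \<tau> i))) v)"
    by (rule alt_sum_sum)
  also have "\<dots> = (\<Sum>\<tau>\<in>?P. alt_sum (k + l) (\<lambda>u. \<alpha> u * \<beta> (\<lambda>i. u (k + i))) v)"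
  proof (intro sum.cong refl)
    fix \<tau> assume "\<tau> \<in> ?P"
    then have \<tau>: "\<tau> permutes {..<l}" by simp
    define \<rho> where "\<rho> = map_permutation {..<l} ((+) k) \<tau>"
    have inj: "inj_on ((+) k) {..<l}" by simp
    have im: "(+) k ` {..<l} = {k..<k + l}"
      by (simp add: lessThan_atLeast0 add.commute)
    have \<rho>: "\<rho> permutes {k..<k + l}"
      unfolding \<rho>_def using \<tau> im by (intro map_permutation_permutes) (auto simp: bij_betw_def)
    then have \<rho>': "\<rho> permutes {..<k + l}"
      by (rule permutes_subset) auto
    have low: "\<rho> i = i" if "i < k" for i
      using permutes_not_in[OF \<rho>] that by simp
    have high: "\<rho> (k + i) = k + \<tau> i" for i
    proof (cases "i < l")
      case True
      then show ?thesis
        unfolding \<rho>_def by (intro map_permutation_apply) auto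
    next
      case False
      then show ?thesis
        using permutes_not_in[OF \<rho>, of "k + i"] permutes_not_in[OF \<tau>, of i] by simp
    qed
    have sgn: "sign \<rho> = sign \<tau>"
      unfolding \<rho>_def using \<tau> inj by (intro sign_map_permutation) auto
    have "\<alpha> (\<lambda>i. u (\<rho> i)) = \<alpha> u" for u :: "nat \<Rightarrow> 'a"
      by (rule assms) (simp add: low)
    with alt_sum_permute[OF \<rho>', of "\<lambda>u. \<alpha> u * \<beta> (\<lambda>i. u (k + i))" v] high sgn
    show "of_int (sign \<tau>) * alt_sum (k + l) (\<lambda>u. \<alpha> u * \<beta> (\<lambda>i. u (k + \<tau> i))) v =
        alt_sum (k + l) (\<lambda>u. \<alpha> u * \<beta> (\<lambda>i. u (k + i))) v"
      using sign_idempotent[of \<tau>] by (simp flip: of_int_mult mult.assoc)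
  qed
  finally show ?thesis
    by (simp add: card_permutations[OF refl])
qed

lemma wedge_eq_alt_sum:
  "wedge k l \<alpha> \<beta> v = alt_sum (k + l) (\<lambda>u. \<alpha> u * \<beta> (\<lambda>i. u (k + i))) v / (fact k * fact l)"
  unfolding wedge_def alt_sum_def by (simp add: mult.assoc)

lemma wedge_sum:
  "wedge k l (\<lambda>u. \<Sum>i\<in>I. a i * \<alpha> i u) (\<lambda>u. \<Sum>j\<in>J. b j * \<beta> j u) v =
     (\<Sum>i\<in>I. \<Sum>j\<in>J. a i * b j * wedge k l (\<alpha> i) (\<beta> j) v)"
proof -
  have "alt_sum (k + l) (\<lambda>u. (\<Sum>i\<in>I. a i * \<alpha> i u) * (\<Sum>j\<in>J. b j * \<beta> j (\<lambda>i. u (k + i)))) v =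
      alt_sum (k + l) (\<lambda>u. \<Sum>p\<in>I\<times>J. (a (fst p) * b (snd p)) *
         (\<alpha> (fst p) u * \<beta> (snd p) (\<lambda>i. u (k + i)))) v"
    by (simp add: sum_product sum.cartesian_product case_prod_beta mult_ac)
  also have "\<dots> = (\<Sum>p\<in>I\<times>J. (a (fst p) * b (snd p)) *
      alt_sum (k + l) (\<lambda>u. \<alpha> (fst p) u * \<beta> (snd p) (\<lambda>i. u (k + i))) v)"
    by (rule alt_sum_sum)
  finally show ?thesis
    by (simp add: wedge_eq_alt_sum sum_divide_distrib sum.cartesian_product case_prod_beta)
qed

lemma wedge_sum_list:
  "wedge k l (\<lambda>u. \<Sum>p\<leftarrow>xs. a p * \<alpha> p u) (\<lambda>u. \<Sum>q\<leftarrow>ys. b q * \<beta> q u) v =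
     (\<Sum>p\<leftarrow>xs. \<Sum>q\<leftarrow>ys. a p * b q * wedge k l (\<alpha> p) (\<beta> q) v)"
  by (simp add: sum_list_sum_nth wedge_sum)

section \<open>Wedges of covectors\<close>

text \<open>
  The inner product turns a vector \<open>a\<close> into the covector \<open>x \<mapsto> x \<bullet> a\<close>. The tensor product of the
  covectors of a list of vectors is defined by recursion on the list, which makes concatenation of
  lists the tensor product of forms.
\<close>

fun flat_tensor :: "'v::euclidean_space list \<Rightarrow> 'v form" where
  "flat_tensor [] u = 1"
| "flat_tensor (a # w) u = (u 0 \<bullet> a) * flat_tensor w (\<lambda>i. u (Suc i))"

lemma flat_tensor_append:
  "flat_tensor (w @ w') u = flat_tensor w u * flat_tensor w' (\<lambda>i. u (length w + i))"
  by (induction w arbitrary: u) auto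

lemma flat_tensor_eq_prod: "flat_tensor w u = (\<Prod>i<length w. u i \<bullet> w ! i)"
  by (induction w arbitrary: u) (auto simp: prod.lessThan_Suc_shift o_def simp del: prod.lessThan_Suc)

lemma multilinear_flat_tensor: "multilinear_form (length w) (flat_tensor w)"
proof (rule multilinear_formI)
  show "flat_tensor w u = flat_tensor w v" if "\<And>i. i < length w \<Longrightarrow> u i = v i" for u v
    using that by (simp add: flat_tensor_eq_prod)
next
  fix v :: "nat \<Rightarrow> 'a" and i assume i: "i < length w"
  have "flat_tensor w (v(i := x)) = (\<Prod>j\<in>{..<length w} - {i}. v j \<bullet> w ! j) * (x \<bullet> w ! i)" for x
    unfolding flat_tensor_eq_prod using i by (subst prod.remove[of _ i]) auto
  then show "linear (\<lambda>x. flat_tensor w (v(i := x)))"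
    by (simp add: linear_iff inner_add_left algebra_simps)
qed

definition flat_wedge :: "'v::euclidean_space list \<Rightarrow> 'v form" where
  "flat_wedge w = alt_sum (length w) (flat_tensor w)"

lemma alternating_flat_wedge: "alternating_form (length w) (flat_wedge w)"
  unfolding flat_wedge_def by (intro alternating_alt_sum multilinear_flat_tensor)

text \<open>
  A half-antisymmetrised version of \<open>wedge_flat_wedge\<close>. It serves the Hodge identity, where an arbitrary
  3-form is expanded into tensors of covectors.
\<close>

lemma wedge_flat_tensor_flat_wedge:
  assumes "length w = k" "length w' = l"
  shows "wedge k l (flat_tensor w) (flat_wedge w') v = flat_wedge (w @ w') v / fact k"
proof -
  have "alt_sum (k + l) (\<lambda>u. flat_tensor w u * alt_sum l (flat_tensor w') (\<lambda>i. u (k + i))) v =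
      fact l * alt_sum (k + l) (\<lambda>u. flat_tensor w u * flat_tensor w' (\<lambda>i. u (k + i))) v"
    using assms by (intro alt_sum_alt_sum_right multilinear_form_cong[OF multilinear_flat_tensor]) simp
  then show ?thesis
    using assms by (simp add: wedge_eq_alt_sum flat_wedge_def flat_tensor_append[abs_def])
qed

lemma wedge_flat_wedge:
  assumes "length w = k" "length w' = l"
  shows "wedge k l (flat_wedge w) (flat_wedge w') = flat_wedge (w @ w')"
proof
  fix v
  have "wedge k l (flat_wedge w) (flat_wedge w') v =
      fact k * wedge k l (flat_tensor w) (flat_wedge w') v"
    using assms unfolding wedge_eq_alt_sum flat_wedge_def[of w]
    by (simp add: alt_sum_alt_sum_left)
  then show "wedge k l (flat_wedge w) (flat_wedge w') v = flat_wedge (w @ w') v"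
    using wedge_flat_tensor_flat_wedge[OF assms, of v] by simp
qed

lemma covector_form_inner: "covector_form (blinfun_inner_right a) = flat_wedge [a]"
proof -
  have "{\<sigma>. \<sigma> permutes {..<Suc 0}} = {id}"
    by (simp add: lessThan_Suc)
  then show ?thesis
    by (intro ext) (simp add: covector_form_def flat_wedge_def alt_sum_def inner_commute)
qed

lemma wedge3_inner:
  "wedge3 (blinfun_inner_right a) (blinfun_inner_right b) (blinfun_inner_right c) = flat_wedge [a, b, c]"
  by (simp add: wedge3_def covector_form_inner wedge_flat_wedge)

lemma flat_wedge_swap: "flat_wedge (w @ a # b # w') v = - flat_wedge (w @ b # a # w') v"
proof -
  let ?n = "length w" and ?m = "Suc (Suc (length w + length w'))"
  let ?t = "Transposition.transpose ?n (Suc ?n)"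
  have t: "?t permutes {..<?m}"
    by (intro permutes_swap_id) auto
  have w: "flat_tensor w (\<lambda>i. u (?t i)) = flat_tensor w u" for u
    by (rule multilinear_form_cong[OF multilinear_flat_tensor]) (simp add: Transposition.transpose_def)
  have w': "flat_tensor w' (\<lambda>i. u (?t (Suc (Suc (?n + i))))) =
      flat_tensor w' (\<lambda>i. u (Suc (Suc (?n + i))))" for u
    by (simp add: Transposition.transpose_def)
  have "flat_tensor (w @ a # b # w') u = flat_tensor (w @ b # a # w') (\<lambda>i. u (?t i))" for u
    by (simp add: flat_tensor_append w w')
  then have "flat_tensor (w @ a # b # w') = (\<lambda>u. flat_tensor (w @ b # a # w') (\<lambda>i. u (?t i)))"
    by blast
  then have "flat_wedge (w @ a # b # w') v =
      alt_sum ?m (\<lambda>u. flat_tensor (w @ b # a # w') (\<lambda>i. u (?t i))) v"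
    by (simp add: flat_wedge_def)
  also have "\<dots> = - flat_wedge (w @ b # a # w') v"
    by (simp add: alt_sum_permute[OF t] flat_wedge_def sign_swap_id)
  finally show ?thesis .
qed

lemma flat_wedge_repeated: "flat_wedge (w @ a # a # w') v = 0"
  using flat_wedge_swap[of w a a w' v] by simp

lemma flat_wedge_sum_entry:
  "flat_wedge (w @ (\<Sum>j\<in>J. c j *\<^sub>R a j) # w') v = (\<Sum>j\<in>J. c j * flat_wedge (w @ a j # w') v)"
proof -
  have "flat_tensor (w @ (\<Sum>j\<in>J. c j *\<^sub>R a j) # w') =
      (\<lambda>u. \<Sum>j\<in>J. c j * flat_tensor (w @ a j # w') u)"
    by (simp add: fun_eq_iff flat_tensor_append inner_sum_right sum_distrib_left sum_distrib_right
        mult_ac)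
  then show ?thesis
    by (simp add: flat_wedge_def alt_sum_sum)
qed

section \<open>Reordering by signed sorting\<close>

text \<open>
  Insertion into a strictly increasing list together with the sign of the necessary permutation. A
  repeated entry makes the wedge vanish, so it is recorded by the sign \<open>0\<close>; the list returned in
  that case is arbitrary.
\<close>

fun insert_signed :: "nat \<Rightarrow> nat list \<Rightarrow> int \<times> nat list" where
  "insert_signed a [] = (1, [a])"
| "insert_signed a (b # l) =
     (if a < b then (1, a # b # l) else if a = b then (0, [])
      else let (s, m) = insert_signed a l in (- s, b # m))"

fun sort_signed :: "nat list \<Rightarrow> int \<times> nat list" where
  "sort_signed [] = (1, [])"
| "sort_signed (a # l) =
     (let (s, m) = sort_signed l; (t, m') = insert_signed a m in (s * t, m'))"

lemma flat_wedge_insert_signed: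
  "flat_wedge (w @ map e (a # l)) v =
     of_int (fst (insert_signed a l)) * flat_wedge (w @ map e (snd (insert_signed a l))) v"
proof (induction l arbitrary: w)
  case Nil
  then show ?case by simp
next
  case (Cons b l)
  show ?case
    using Cons[of "w @ [e b]"] flat_wedge_swap[of w "e a" "e b" "map e l" v]
      flat_wedge_repeated[of w "e a" "map e l" v]
    by (auto simp: case_prod_beta)
qed

lemma flat_wedge_sort_signed:
  "flat_wedge (w @ map e l) v =
     of_int (fst (sort_signed l)) * flat_wedge (w @ map e (snd (sort_signed l))) v"
proof (induction l arbitrary: w)
  case Nil
  then show ?case by simp
next
  case (Cons a l)
  show ?case
    using Cons[of "w @ [e a]"]
      flat_wedge_insert_signed[of w e a "snd (sort_signed l)" v]
    by (simp add: case_prod_beta)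
qed

lemma insert_signed_sorted:
  assumes "fst (insert_signed a l) \<noteq> 0" "sorted_wrt (<) l"
  shows "sorted_wrt (<) (snd (insert_signed a l)) \<and>
    set (snd (insert_signed a l)) = insert a (set l)"
  using assms by (induction l) (auto simp: case_prod_beta split: if_splits)

lemma sort_signed_sorted:
  assumes "fst (sort_signed l) \<noteq> 0"
  shows "sorted_wrt (<) (snd (sort_signed l)) \<and> set (snd (sort_signed l)) = set l"
  using assms
proof (induction l)
  case (Cons a l)
  then show ?case
    using insert_signed_sorted[of a "snd (sort_signed l)"] by (auto simp: case_prod_beta)
qed simp

lemma insert_signed_length: "fst (insert_signed a l) \<noteq> 0 \<Longrightarrow> length (snd (insert_signed a l)) = Suc (length l)"
  by (induction l) (auto simp: case_prod_beta split: if_splits)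

lemma sort_signed_length: "fst (sort_signed l) \<noteq> 0 \<Longrightarrow> length (snd (sort_signed l)) = length l"
  by (induction l) (auto simp: case_prod_beta insert_signed_length)

text \<open>
  If the sign is not \<open>0\<close>, sorting yields a strictly increasing list of \<open>n\<close> numbers below \<open>n\<close>, and
  \<open>[0..<n]\<close> is the only one.
\<close>

lemma flat_wedge_top_degree:
  assumes "length l = n" "set l \<subseteq> {..<n}"
  shows "flat_wedge (map e l) v =
    of_int (fst (sort_signed l)) * flat_wedge (map e [0..<n]) v"
proof (cases "fst (sort_signed l) = 0")
  case True
  then show ?thesis
    using flat_wedge_sort_signed[of "[]" e l v] by simp
next
  case False
  let ?m = "snd (sort_signed l)"
  have m: "sorted_wrt (<) ?m" "set ?m = set l" "length ?m = n"
    using sort_signed_sorted[OF False] sort_signed_length[OF False] assms by auto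
  then have "card (set ?m) = n"
    using distinct_card[of ?m] by (auto simp: strict_sorted_iff)
  then have "set ?m = {..<n}"
    using m assms by (intro card_subset_eq) auto
  then have "?m = [0..<n]"
    using m(1) by (intro sorted_distinct_set_unique) (simp_all add: strict_sorted_iff atLeast0LessThan)
  then show ?thesis
    using flat_wedge_sort_signed[of "[]" e l v] by simp
qed

section \<open>Integer combinations of wedges\<close>

text \<open>
  Lists of a coefficient and an index list represent forms with integer coefficients in a frame, so
  that identities between such forms can be checked by rewriting.
\<close>

definition wedge_comb :: "(nat \<Rightarrow> 'v::euclidean_space) \<Rightarrow> (int \<times> nat list) list \<Rightarrow> 'v form" where
  "wedge_comb e xs = (\<lambda>v. \<Sum>p\<leftarrow>xs. of_int (fst p) * flat_wedge (map e (snd p)) v)"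

definition mult_comb :: "(int \<times> nat list) list \<Rightarrow> (int \<times> nat list) list \<Rightarrow> (int \<times> nat list) list" where
  "mult_comb xs ys = concat (map (\<lambda>p. map (\<lambda>q. (fst p * fst q, snd p @ snd q)) ys) xs)"

definition homogeneous_comb :: "nat \<Rightarrow> nat \<Rightarrow> (int \<times> nat list) list \<Rightarrow> bool" where
  "homogeneous_comb n k xs \<longleftrightarrow> list_all (\<lambda>p. length (snd p) = k \<and> list_all (\<lambda>a. a < n) (snd p)) xs"

lemma alternating_wedge_comb:
  assumes "homogeneous_comb n k xs"
  shows "alternating_form k (wedge_comb e xs)"
proof -
  have "alternating_form k (flat_wedge (map e (snd (xs ! i))))" if "i < length xs" for i
    using alternating_flat_wedge[of "map e (snd (xs ! i))"] assms that
    by (auto simp: homogeneous_comb_def list_all_length)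
  then have "alternating_form k (\<lambda>v. \<Sum>i = 0..<length xs.
      of_int (fst (xs ! i)) * flat_wedge (map e (snd (xs ! i))) v)"
    by (intro alternating_form_sum) auto
  then show ?thesis
    by (simp add: wedge_comb_def sum_list_sum_nth)
qed

lemma sum_list_mult_comb:
  "(\<Sum>r\<leftarrow>mult_comb xs ys. f r) = (\<Sum>p\<leftarrow>xs. \<Sum>q\<leftarrow>ys. f (fst p * fst q, snd p @ snd q))"
  by (induction xs) (simp_all add: mult_comb_def o_def)

lemma homogeneous_mult_comb:
  assumes "homogeneous_comb n k xs" "homogeneous_comb n l ys"
  shows "homogeneous_comb n (k + l) (mult_comb xs ys)"
  using assms unfolding homogeneous_comb_def mult_comb_def list_all_iff by auto

lemma wedge_wedge_comb:
  assumes "homogeneous_comb n k xs" "homogeneous_comb n l ys"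
  shows "wedge k l (wedge_comb e xs) (wedge_comb e ys) = wedge_comb e (mult_comb xs ys)"
proof
  fix v
  have "wedge k l (wedge_comb e xs) (wedge_comb e ys) v = (\<Sum>p\<leftarrow>xs. \<Sum>q\<leftarrow>ys.
      of_int (fst p) * of_int (fst q) *
      wedge k l (flat_wedge (map e (snd p))) (flat_wedge (map e (snd q))) v)"
    unfolding wedge_comb_def by (rule wedge_sum_list)
  also have "\<dots> = (\<Sum>p\<leftarrow>xs. \<Sum>q\<leftarrow>ys. of_int (fst p * fst q) * flat_wedge (map e (snd p @ snd q)) v)"
    using assms
    by (intro arg_cong[where f = sum_list] map_cong refl)
      (auto simp: homogeneous_comb_def list_all_iff wedge_flat_wedge)
  also have "\<dots> = wedge_comb e (mult_comb xs ys) v"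
    by (simp add: wedge_comb_def sum_list_mult_comb)
  finally show "wedge k l (wedge_comb e xs) (wedge_comb e ys) v = \<dots>" .
qed

definition top_coeff :: "(int \<times> nat list) list \<Rightarrow> int" where
  "top_coeff xs = (\<Sum>p\<leftarrow>xs. fst p * fst (sort_signed (snd p)))"

lemma wedge_comb_top_degree:
  assumes "homogeneous_comb n n xs"
  shows "wedge_comb e xs v = of_int (top_coeff xs) * flat_wedge (map e [0..<n]) v"
proof -
  have "wedge_comb e xs v = (\<Sum>p\<leftarrow>xs. of_int (fst p * fst (sort_signed (snd p))) * flat_wedge (map e [0..<n]) v)"
    unfolding wedge_comb_def
  proof (intro arg_cong[where f = sum_list] map_cong refl)
    fix p assume "p \<in> set xs"
    then have "length (snd p) = n" "set (snd p) \<subseteq> {..<n}"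
      using assms by (auto simp: homogeneous_comb_def list_all_iff)
    from flat_wedge_top_degree[OF this, of e v]
    show "of_int (fst p) * flat_wedge (map e (snd p)) v =
        of_int (fst p * fst (sort_signed (snd p))) * flat_wedge (map e [0..<n]) v"
      by simp
  qed
  then show ?thesis
    by (simp add: top_coeff_def sum_list_sum_nth sum_distrib_right)
qed

section \<open>Interior products of 3-forms\<close>

lemma flat_wedge2: "flat_wedge [a, b] v = (v 0 \<bullet> a) * (v 1 \<bullet> b) - (v 1 \<bullet> a) * (v 0 \<bullet> b)"
proof -
  have *: "{..<length [a, b]} = {0, 1}"
    by (simp add: lessThan_Suc insert_commute)
  have f: "finite {1::nat}" "0 \<notin> {1::nat}"
    by simp_all
  show ?thesis
    unfolding flat_wedge_def alt_sum_def *
    unfolding sum_over_permutations_insert[OF f]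
    unfolding permutes_sing
    by (simp add: sign_swap_id permutation_swap_id sign_compose Transposition.transpose_def)
qed

lemma flat_wedge3:
  "flat_wedge [a, b, c] v =
     (v 0 \<bullet> a) * (v 1 \<bullet> b) * (v 2 \<bullet> c) + (v 1 \<bullet> a) * (v 2 \<bullet> b) * (v 0 \<bullet> c)
   + (v 2 \<bullet> a) * (v 0 \<bullet> b) * (v 1 \<bullet> c) - (v 0 \<bullet> a) * (v 2 \<bullet> b) * (v 1 \<bullet> c)
   - (v 1 \<bullet> a) * (v 0 \<bullet> b) * (v 2 \<bullet> c) - (v 2 \<bullet> a) * (v 1 \<bullet> b) * (v 0 \<bullet> c)"
proof -
  have *: "{..<length [a, b, c]} = {0, 1, Suc 1}"
    by (simp add: lessThan_Suc insert_commute)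
  have f123: "finite {1::nat, Suc 1}" "0 \<notin> {1::nat, Suc 1}" and f23: "finite {Suc 1}" "1 \<notin> {Suc 1}"
    by simp_all
  show ?thesis
    unfolding flat_wedge_def alt_sum_def *
    unfolding sum_over_permutations_insert[OF f123]
    unfolding sum_over_permutations_insert[OF f23]
    unfolding permutes_sing
    by (simp add: sign_swap_id permutation_swap_id sign_compose Transposition.transpose_def
        numeral_2_eq_2)
qed

lemma interior_product_flat_wedge3:
  "interior_product x (flat_wedge [a, b, c]) v =
     (x \<bullet> a) * flat_wedge [b, c] v - (x \<bullet> b) * flat_wedge [a, c] v + (x \<bullet> c) * flat_wedge [a, b] v"
  by (simp add: interior_product_def flat_wedge2 flat_wedge3 numeral_2_eq_2 algebra_simps)

text \<open>
  The combination that represents the interior product of a 3-form with the \<open>i\<close>-th frame vector.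
\<close>

definition contract_comb :: "nat \<Rightarrow> (int \<times> nat list) list \<Rightarrow> (int \<times> nat list) list" where
  "contract_comb i xs = concat (map (\<lambda>(c, l). case l of [a, b, d] \<Rightarrow>
       (if a = i then [(c, [b, d])] else []) @ (if b = i then [(- c, [a, d])] else []) @
       (if d = i then [(c, [a, b])] else []) | _ \<Rightarrow> []) xs)"

lemma wedge_comb_Nil [simp]: "wedge_comb e [] v = 0"
  by (simp add: wedge_comb_def)

lemma wedge_comb_Cons:
  "wedge_comb e ((c, l) # xs) v = of_int c * flat_wedge (map e l) v + wedge_comb e xs v"
  by (simp add: wedge_comb_def)

lemma wedge_comb_append [simp]: "wedge_comb e (xs @ ys) v = wedge_comb e xs v + wedge_comb e ys v"
  by (simp add: wedge_comb_def)

lemma interior_product_wedge_comb: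
  assumes "homogeneous_comb n 3 xs"
  shows "interior_product x (wedge_comb e xs) v = (\<Sum>i<n. (x \<bullet> e i) * wedge_comb e (contract_comb i xs) v)"
  using assms
proof (induction xs)
  case Nil
  then show ?case
    by (simp add: interior_product_def contract_comb_def)
next
  case (Cons p xs)
  have "length (snd p) = 3"
    using Cons.prems by (simp add: homogeneous_comb_def)
  then obtain a b d where abd: "snd p = [a, b, d]"
    by (auto simp: numeral_3_eq_3 length_Suc_conv)
  then have n: "a < n" "b < n" "d < n"
    using Cons.prems by (simp_all add: homogeneous_comb_def)
  obtain c where p: "p = (c, [a, b, d])"
    using abd by (cases p) simp
  have summand: "(x \<bullet> e i) * wedge_comb e (contract_comb i (p # xs)) v =
      (if i = a then (x \<bullet> e a) * (c * flat_wedge [e b, e d] v) else 0) +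
      (if i = b then (x \<bullet> e b) * (- c * flat_wedge [e a, e d] v) else 0) +
      (if i = d then (x \<bullet> e d) * (c * flat_wedge [e a, e b] v) else 0) +
      (x \<bullet> e i) * wedge_comb e (contract_comb i xs) v" for i
    by (auto simp: p contract_comb_def wedge_comb_Cons algebra_simps)
  have "interior_product x (wedge_comb e (p # xs)) v =
      c * interior_product x (flat_wedge [e a, e b, e d]) v + interior_product x (wedge_comb e xs) v"
    by (simp add: interior_product_def p wedge_comb_Cons)
  also have "interior_product x (wedge_comb e xs) v =
      (\<Sum>i<n. (x \<bullet> e i) * wedge_comb e (contract_comb i xs) v)"
    using Cons by (simp add: homogeneous_comb_def)
  finally show ?case
    unfolding summand using n by (simp add: sum.distrib interior_product_flat_wedge3 algebra_simps)
qed

section \<open>The standard frame and its volume form\<close>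

text \<open>
  An arbitrary enumeration of the basis, so that forms can be indexed by natural numbers.
\<close>

definition std_frame :: "nat \<Rightarrow> 'v::euclidean_space" where
  "std_frame = (SOME e. bij_betw e {..<DIM('v)} (Basis :: 'v set))"

lemma bij_betw_std_frame: "bij_betw std_frame {..<DIM('v)} (Basis :: 'v::euclidean_space set)"
proof -
  have "\<exists>e. bij_betw e {..<DIM('v)} (Basis :: 'v set)"
    using ex_bij_betw_nat_finite[OF finite_Basis] by (simp add: atLeast0LessThan)
  then show ?thesis
    unfolding std_frame_def by (rule someI_ex)
qed

lemma inner_std_frame:
  assumes "i < DIM('v)" "j < DIM('v)"
  shows "(std_frame i :: 'v::euclidean_space) \<bullet> std_frame j = (if i = j then 1 else 0)"
proof -
  have "(std_frame i :: 'v) \<in> Basis" "(std_frame j :: 'v) \<in> Basis"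
    using bij_betw_std_frame[where 'v = 'v] assms by (auto simp: bij_betw_def)
  moreover have "(std_frame i :: 'v) = std_frame j \<longleftrightarrow> i = j"
    using bij_betw_std_frame[where 'v = 'v] assms by (auto simp: bij_betw_def inj_on_def)
  ultimately show ?thesis
    by (simp add: inner_Basis)
qed

lemma orthonormal_std_frame: "orthonormal_frame (\<bullet>) (std_frame :: nat \<Rightarrow> 'v::euclidean_space)"
  by (simp add: orthonormal_frame_def inner_std_frame)

lemma std_frame_expansion:
  "(\<Sum>i<DIM('v). (x \<bullet> std_frame i) *\<^sub>R std_frame i) = (x :: 'v::euclidean_space)"
  using sum.reindex_bij_betw[OF bij_betw_std_frame[where 'v = 'v], of "\<lambda>b. (x \<bullet> b) *\<^sub>R b"]
  by (simp add: euclidean_representation)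

lemma inner_std_frame_expansion:
  "(\<Sum>i<DIM('v). (x \<bullet> std_frame i) * (y \<bullet> std_frame i)) = (x :: 'v::euclidean_space) \<bullet> y"
proof -
  have "x \<bullet> (\<Sum>i<DIM('v). (y \<bullet> std_frame i) *\<^sub>R std_frame i) = x \<bullet> y"
    by (simp only: std_frame_expansion)
  then show ?thesis
    by (simp add: inner_sum_right mult.commute)
qed

text \<open>
  The arguments are expanded in the frame one after the other: after \<open>m\<close> steps the first \<open>m\<close> arguments
  are frame vectors and the others are still arbitrary.
\<close>

lemma multilinear_form_expansion:
  fixes v :: "nat \<Rightarrow> 'v::euclidean_space"
  assumes "multilinear_form k \<alpha>"
  shows "\<alpha> v = (\<Sum>I\<in>{..<k} \<rightarrow>\<^sub>E {..<DIM('v)}.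
    (\<Prod>i<k. v i \<bullet> std_frame (I i)) * \<alpha> (\<lambda>i. std_frame (I i)))"
proof -
  let ?D = "{..<DIM('v)}" and ?e = "std_frame :: nat \<Rightarrow> 'v"
  let ?u = "\<lambda>m I i. if i < m then ?e (I i) else v i"
  have "\<alpha> v = (\<Sum>I\<in>{..<m} \<rightarrow>\<^sub>E ?D. (\<Prod>i<m. v i \<bullet> ?e (I i)) * \<alpha> (?u m I))" if "m \<le> k" for m
    using that
  proof (induction m)
    case 0
    then show ?case by simp
  next
    case (Suc m)
    have step: "\<alpha> (?u m I) = (\<Sum>j\<in>?D. (v m \<bullet> ?e j) * \<alpha> (?u (Suc m) (I(m := j))))" for I
    proof -
      have lin: "linear (\<lambda>x. \<alpha> ((?u m I)(m := x)))"
        using assms Suc.prems by (intro multilinear_form_linear) auto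
      have upd: "(?u m I)(m := ?e j) = ?u (Suc m) (I(m := j))" for j
        by (auto simp: fun_eq_iff less_Suc_eq)
      have "\<alpha> (?u m I) = \<alpha> ((?u m I)(m := \<Sum>j\<in>?D. (v m \<bullet> ?e j) *\<^sub>R ?e j))"
        by (intro arg_cong[where f = \<alpha>]) (auto simp: std_frame_expansion)
      also have "\<dots> = (\<Sum>j\<in>?D. (v m \<bullet> ?e j) * \<alpha> ((?u m I)(m := ?e j)))"
        by (simp add: linear_sum[OF lin] linear_cmul[OF lin])
      finally show ?thesis
        by (simp only: upd)
    qed
    have "\<alpha> v = (\<Sum>I\<in>{..<m} \<rightarrow>\<^sub>E ?D. (\<Prod>i<m. v i \<bullet> ?e (I i)) * \<alpha> (?u m I))"
      using Suc by simp
    also have "\<dots> = (\<Sum>I\<in>{..<m} \<rightarrow>\<^sub>E ?D. \<Sum>j\<in>?D.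
        (\<Prod>i<Suc m. v i \<bullet> ?e ((I(m := j)) i)) * \<alpha> (?u (Suc m) (I(m := j))))"
      unfolding step sum_distrib_left by (intro sum.cong refl) simp
    also have "\<dots> = (\<Sum>(j, I)\<in>?D \<times> ({..<m} \<rightarrow>\<^sub>E ?D).
        (\<Prod>i<Suc m. v i \<bullet> ?e ((I(m := j)) i)) * \<alpha> (?u (Suc m) (I(m := j))))"
      by (subst sum.swap) (simp only: sum.cartesian_product)
    also have "\<dots> = (\<Sum>I\<in>{..<Suc m} \<rightarrow>\<^sub>E ?D. (\<Prod>i<Suc m. v i \<bullet> ?e (I i)) * \<alpha> (?u (Suc m) I))"
      unfolding lessThan_Suc[of m] PiE_insert_eq
      by (subst sum.reindex) (auto intro!: inj_combinator simp: case_prod_beta o_def cong del: if_weak_cong)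
    finally show ?case .
  qed
  from this[of k] have "\<alpha> v = (\<Sum>I\<in>{..<k} \<rightarrow>\<^sub>E ?D. (\<Prod>i<k. v i \<bullet> ?e (I i)) * \<alpha> (?u k I))"
    by simp
  moreover have "\<alpha> (?u k I) = \<alpha> (\<lambda>i. ?e (I i))" for I
    by (rule multilinear_form_cong[OF assms]) simp
  ultimately show ?thesis by simp
qed

definition std_volume :: "('v::euclidean_space) form" where
  "std_volume = flat_wedge (map std_frame [0..<DIM('v)])"

text \<open>
  The prefix \<open>l\<close> of frame vectors makes the induction possible: expanding the next vector in the frame
  moves it into the prefix, and once all entries are frame vectors, sorting applies. The factor \<open>c\<close>
  does not depend on \<open>v\<close>.
\<close>

lemma flat_wedge_proportional_volume:
  fixes w :: "'v::euclidean_space list"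
  assumes "set l \<subseteq> {..<DIM('v)}" "length l + length w = DIM('v)"
  shows "\<exists>c. \<forall>v. flat_wedge (map std_frame l @ w) v = c * std_volume v"
  using assms
proof (induction w arbitrary: l)
  case Nil
  then show ?case
    using flat_wedge_top_degree[of l "DIM('v)" "std_frame :: nat \<Rightarrow> 'v"] by (auto simp: std_volume_def)
next
  case (Cons a w)
  have "\<exists>c. \<forall>v. flat_wedge (map std_frame (l @ [i]) @ w) v = c * std_volume v" if "i < DIM('v)" for i
    using Cons.IH[of "l @ [i]"] Cons.prems that by simp
  then obtain c where c:
    "\<And>i v. i < DIM('v) \<Longrightarrow> flat_wedge (map std_frame (l @ [i]) @ w) v = c i * std_volume v"
    by metis
  have "flat_wedge (map std_frame l @ a # w) v =
      (\<Sum>i<DIM('v). (a \<bullet> std_frame i) * c i) * std_volume v" for v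
  proof -
    have "flat_wedge (map std_frame l @ a # w) v =
        flat_wedge (map std_frame l @ (\<Sum>i<DIM('v). (a \<bullet> std_frame i) *\<^sub>R std_frame i) # w) v"
      by (simp add: std_frame_expansion)
    also have "\<dots> = (\<Sum>i<DIM('v). (a \<bullet> std_frame i) * (c i * std_volume v))"
      unfolding flat_wedge_sum_entry using c by (intro sum.cong refl) simp
    finally show ?thesis
      by (simp add: sum_distrib_right mult.assoc)
  qed
  then show ?case by blast
qed

text \<open>
  A flat wedge is the determinant of the matrix of the products \<open>b i \<bullet> a j\<close>, and a matrix and its
  transpose have the same determinant.
\<close>

lemma flat_wedge_transpose: "flat_wedge (map a [0..<n]) b = flat_wedge (map b [0..<n]) a"
proof -
  have "flat_wedge (map a [0..<n]) b =
      (\<Sum>\<sigma> | \<sigma> permutes {..<n}. of_int (sign \<sigma>) * (\<Prod>i<n. b (\<sigma> i) \<bullet> a i))"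
    by (simp add: flat_wedge_def alt_sum_def flat_tensor_eq_prod)
  also have "\<dots> = (\<Sum>\<sigma> | \<sigma> permutes {..<n}. of_int (sign (inv_into UNIV \<sigma>)) *
      (\<Prod>i<n. b (inv_into UNIV \<sigma> i) \<bullet> a i))"
    by (rule sum_permutations_inverse)
  also have "\<dots> = (\<Sum>\<sigma> | \<sigma> permutes {..<n}. of_int (sign \<sigma>) * (\<Prod>i<n. a (\<sigma> i) \<bullet> b i))"
  proof (intro sum.cong refl arg_cong2[where f = "(*)"])
    fix \<sigma> assume "\<sigma> \<in> {\<sigma>. \<sigma> permutes {..<n}}"
    then have \<sigma>: "\<sigma> permutes {..<n}" by simp
    then show "real_of_int (sign (inv_into UNIV \<sigma>)) = of_int (sign \<sigma>)"
      using permutation_permutes[of \<sigma>] by (subst sign_inverse) auto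
    show "(\<Prod>i<n. b (inv_into UNIV \<sigma> i) \<bullet> a i) = (\<Prod>i<n. a (\<sigma> i) \<bullet> b i)"
      using permutes_inverses[OF \<sigma>]
      by (subst prod.permute[OF \<sigma>]) (simp add: o_def inner_commute)
  qed
  also have "\<dots> = flat_wedge (map b [0..<n]) a"
    by (simp add: flat_wedge_def alt_sum_def flat_tensor_eq_prod)
  finally show ?thesis .
qed

lemma flat_wedge_orthonormal:
  assumes "\<And>i j. i < n \<Longrightarrow> j < n \<Longrightarrow> f i \<bullet> f j = (if i = j then 1 else 0)"
  shows "flat_wedge (map f [0..<n]) f = 1"
proof -
  have "(\<Prod>i<n. f (\<sigma> i) \<bullet> f i) = (if \<sigma> = id then 1 else 0)" if \<sigma>: "\<sigma> permutes {..<n}" for \<sigma>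
  proof (cases "\<sigma> = id")
    case True
    then show ?thesis
      using assms by simp
  next
    case False
    then obtain i where i: "\<sigma> i \<noteq> i" by (auto simp: fun_eq_iff)
    then have "i < n"
      using permutes_not_in[OF \<sigma>, of i] by auto
    moreover have "\<sigma> i < n"
      using permutes_in_image[OF \<sigma>, of i] \<open>i < n\<close> by simp
    ultimately have "f (\<sigma> i) \<bullet> f i = 0" "i \<in> {..<n}"
      using assms i by auto
    then have "(\<Prod>i<n. f (\<sigma> i) \<bullet> f i) = 0"
      by (intro prod_zero) auto
    then show ?thesis
      using False by simp
  qed
  then have "flat_wedge (map f [0..<n]) f =
      (\<Sum>\<sigma> | \<sigma> permutes {..<n}. of_int (sign \<sigma>) * (if \<sigma> = id then 1 else 0))"
    by (simp add: flat_wedge_def alt_sum_def flat_tensor_eq_prod)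
  also have "\<dots> = (\<Sum>\<sigma> | \<sigma> permutes {..<n}. if \<sigma> = id then 1 else 0)"
    by (intro sum.cong) auto
  also have "\<dots> = 1"
    by (simp add: finite_permutations permutes_id)
  finally show ?thesis .
qed

text \<open>
  Let \<open>f\<close> be orthonormal and \<open>e\<close> the standard frame. The wedge of \<open>f\<close> is a multiple of that of \<open>e\<close>. At
  \<open>e\<close> the factor is seen to be the volume of \<open>f\<close>, by transposition; at \<open>f\<close> itself the wedge is \<open>1\<close>. So
  the square of the volume of \<open>f\<close> is \<open>1\<close>. This is the proof that orthogonal matrices have determinant
  \<open>1\<close> or \<open>-1\<close>.
\<close>

lemma volume_form_std_volume: "volume_form (\<bullet>) (std_volume :: ('v::euclidean_space) form)"
  unfolding volume_form_def
proof (intro conjI allI impI)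
  show "alternating_form DIM('v) (std_volume :: 'v form)"
    using alternating_flat_wedge[of "map (std_frame :: nat \<Rightarrow> 'v) [0..<DIM('v)]"]
    by (simp add: std_volume_def)
next
  fix f :: "nat \<Rightarrow> 'v" assume f: "orthonormal_frame (\<bullet>) f"
  let ?n = "DIM('v)"
  obtain c where c: "\<And>v. flat_wedge (map f [0..<?n]) v = c * std_volume v"
    using flat_wedge_proportional_volume[of "[]" "map f [0..<?n]"] by auto
  have "std_volume (std_frame :: nat \<Rightarrow> 'v) = 1"
    unfolding std_volume_def by (intro flat_wedge_orthonormal inner_std_frame)
  then have "c = std_volume f"
    using c[of std_frame] flat_wedge_transpose[of f ?n std_frame] by (simp add: std_volume_def)
  moreover have "flat_wedge (map f [0..<?n]) f = 1"
    using f by (intro flat_wedge_orthonormal) (auto simp: orthonormal_frame_def)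
  ultimately have "std_volume f * std_volume f = 1"
    using c[of f] by simp
  then show "\<bar>std_volume f\<bar> = 1"
    by (metis abs_mult_self_eq abs_1 abs_mult power2_eq_square real_sqrt_abs real_sqrt_one)
qed

lemma inner_product_inner: "inner_product ((\<bullet>) :: 'v::euclidean_space \<Rightarrow> 'v \<Rightarrow> real)"
  unfolding inner_product_def
  by (auto simp: inner_commute linear_iff inner_add_right)

section \<open>The standard G2-form and its dual\<close>

text \<open>
  The indices \<open>1, \<dots>, 7\<close> of the coframe are shifted to \<open>0, \<dots>, 6\<close>.
\<close>

definition g2_comb :: "(int \<times> nat list) list" where
  "g2_comb = [(1, [0, 1, 6]), (1, [2, 3, 6]), (1, [4, 5, 6]), (1, [0, 2, 4]),
     (-1, [1, 2, 5]), (-1, [0, 3, 5]), (-1, [1, 3, 4])]"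

text \<open>
  Each monomial of the 3-form is replaced by the wedge of the four complementary covectors, with the
  sign that makes the product of the two a positive multiple of the volume form.
\<close>

definition g2_dual_comb :: "(int \<times> nat list) list" where
  "g2_dual_comb = [(1, [2, 3, 4, 5]), (1, [0, 1, 4, 5]), (1, [0, 1, 2, 3]), (-1, [1, 3, 5, 6]),
     (1, [0, 3, 4, 6]), (1, [1, 2, 4, 6]), (1, [0, 2, 5, 6])]"

text \<open>
  The value on the frame vectors \<open>i, j, k\<close> of the 3-form that \<open>xs\<close> represents: each summand is a
  \<open>3 \<times> 3\<close> determinant of Kronecker deltas. Products of \<open>of_bool\<close> keep the simplifier from splitting
  into cases.
\<close>

definition frame_value3 :: "(int \<times> nat list) list \<Rightarrow> nat \<Rightarrow> nat \<Rightarrow> nat \<Rightarrow> int" where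
  "frame_value3 xs i j k = (\<Sum>(c, l)\<leftarrow>xs. case l of [a, b, d] \<Rightarrow>
     c * (of_bool (i = a) * of_bool (j = b) * of_bool (k = d) + of_bool (j = a) * of_bool (k = b) * of_bool (i = d)
        + of_bool (k = a) * of_bool (i = b) * of_bool (j = d) - of_bool (i = a) * of_bool (k = b) * of_bool (j = d)
        - of_bool (j = a) * of_bool (i = b) * of_bool (k = d) - of_bool (k = a) * of_bool (j = b) * of_bool (i = d)) | _ \<Rightarrow> 0)"

text \<open>
  The metric identity for frame vectors: the top coefficient of \<open>\<iota>\<^sub>i \<phi> \<and> \<iota>\<^sub>j \<phi> \<and> \<phi>\<close> is \<open>6 \<delta>\<^sub>i\<^sub>j\<close>.
\<close>

lemma g2_metric_coeffs:
  "list_all (\<lambda>i. list_all (\<lambda>j. top_coeff (mult_comb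
     (mult_comb (contract_comb i g2_comb) (contract_comb j g2_comb)) g2_comb) =
     (if i = j then 6 else 0)) [0..<7]) [0..<7]"
  by code_simp

text \<open>
  The Hodge identity for monomials: \<open>e\<^sup>i \<and> e\<^sup>j \<and> e\<^sup>k \<and> \<psi>\<close> is \<open>\<phi> (e\<^sub>i, e\<^sub>j, e\<^sub>k)\<close> times the volume form.
\<close>

lemma g2_hodge_coeffs:
  "list_all (\<lambda>i. list_all (\<lambda>j. list_all (\<lambda>k.
     top_coeff (mult_comb [(1, [i, j, k])] g2_dual_comb) = frame_value3 g2_comb i j k)
     [0..<7]) [0..<7]) [0..<7]"
  by code_simp



lemma homogeneous_g2_comb: "homogeneous_comb 7 3 g2_comb"
  by (simp add: homogeneous_comb_def g2_comb_def)

lemma homogeneous_g2_dual_comb: "homogeneous_comb 7 4 g2_dual_comb"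
  by (simp add: homogeneous_comb_def g2_dual_comb_def)

lemma homogeneous_contract_comb:
  "homogeneous_comb n 3 xs \<Longrightarrow> homogeneous_comb n 2 (contract_comb i xs)"
  by (auto simp: homogeneous_comb_def contract_comb_def list_all_iff numeral_3_eq_3 length_Suc_conv
      split: if_splits)

lemma top_coeff_metric:
  "i < 7 \<Longrightarrow> j < 7 \<Longrightarrow> top_coeff (mult_comb
     (mult_comb (contract_comb i g2_comb) (contract_comb j g2_comb)) g2_comb) =
     (if i = j then 6 else 0)"
  using g2_metric_coeffs unfolding list_all_iff by simp

lemma top_coeff_hodge:
  "i < 7 \<Longrightarrow> j < 7 \<Longrightarrow> k < 7 \<Longrightarrow>
     top_coeff (mult_comb [(1, [i, j, k])] g2_dual_comb) = frame_value3 g2_comb i j k"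
  using g2_hodge_coeffs unfolding list_all_iff by simp

definition flat_g2 :: "('v::euclidean_space) form" where
  "flat_g2 = wedge_comb std_frame g2_comb"

definition flat_g2_dual :: "('v::euclidean_space) form" where
  "flat_g2_dual = wedge_comb std_frame g2_dual_comb"

lemma alternating_flat_g2: "alternating_form 3 flat_g2"
  unfolding flat_g2_def by (rule alternating_wedge_comb[OF homogeneous_g2_comb])

lemma alternating_flat_g2_dual: "alternating_form 4 flat_g2_dual"
  unfolding flat_g2_dual_def by (rule alternating_wedge_comb[OF homogeneous_g2_dual_comb])

lemma wedge_comb_std_volume:
  assumes "homogeneous_comb 7 7 xs" "DIM('v) = 7"
  shows "wedge_comb std_frame xs v = of_int (top_coeff xs) * (std_volume :: ('v::euclidean_space) form) v"
  using wedge_comb_top_degree[OF assms(1), of "std_frame :: nat \<Rightarrow> 'v"] assms(2)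
  by (simp add: std_volume_def)

lemma linear_blinfun_inner_right: "linear (blinfun_inner_right :: 'v::euclidean_space \<Rightarrow> _)"
  by (rule linearI) (auto intro!: blinfun_eqI simp: blinfun.bilinear_simps inner_add_left)

lemma inj_blinfun_inner_right: "inj (blinfun_inner_right :: 'v::euclidean_space \<Rightarrow> _)"
proof (rule injI)
  fix a b :: 'v assume "blinfun_inner_right a = blinfun_inner_right b"
  then have "a \<bullet> x = b \<bullet> x" for x
    by (metis blinfun_inner_right.rep_eq)
  then show "a = b"
    using vector_eq_rdot by blast
qed

lemma surj_blinfun_inner_right: "surj (blinfun_inner_right :: 'v::euclidean_space \<Rightarrow> _)"
proof (rule surjI)
  fix L :: "'v \<Rightarrow>\<^sub>L real"
  show "blinfun_inner_right (\<Sum>b\<in>Basis. blinfun_apply L b *\<^sub>R b) = L"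
  proof (rule blinfun_eqI)
    fix x :: 'v
    have "blinfun_apply L x = blinfun_apply L (\<Sum>b\<in>Basis. (x \<bullet> b) *\<^sub>R b)"
      by (simp add: euclidean_representation)
    also have "\<dots> = (\<Sum>b\<in>Basis. (x \<bullet> b) * blinfun_apply L b)"
      by (simp add: blinfun.sum_right blinfun.scaleR_right)
    finally show "blinfun_apply (blinfun_inner_right (\<Sum>b\<in>Basis. blinfun_apply L b *\<^sub>R b)) x =
        blinfun_apply L x"
      by (simp add: inner_sum_left inner_sum_right inner_commute mult.commute)
  qed
qed

text \<open>
  The coframe of the definition is the dual of the standard frame. It is a basis of the dual space
  because the Riesz map is a linear isomorphism.
\<close>

lemma g2_form_flat_g2:
  assumes "DIM('v::euclidean_space) = 7"
  shows "g2_form (flat_g2 :: 'v form)"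
proof -
  define \<eta> :: "nat \<Rightarrow> 'v \<Rightarrow>\<^sub>L real" where "\<eta> i = blinfun_inner_right (std_frame (i - 1))" for i
  have "bij_betw (\<lambda>i. i - 1) {1..7} {..<DIM('v)}"
    unfolding assms by (rule bij_betw_byWitness[where f' = Suc]) auto
  then have bij: "bij_betw (std_frame \<circ> (\<lambda>i. i - 1)) {1..7} (Basis :: 'v set)"
    using bij_betw_std_frame by (rule bij_betw_trans)
  have \<eta>: "\<eta> = blinfun_inner_right \<circ> (std_frame \<circ> (\<lambda>i. i - 1))"
    by (simp add: fun_eq_iff \<eta>_def)
  have img: "\<eta> ` {1..7} = blinfun_inner_right ` (Basis :: 'v set)"
    unfolding \<eta> using bij by (metis bij_betw_def image_comp)
  have "inj_on \<eta> {1..7}"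
    unfolding \<eta>
    by (rule comp_inj_on[OF bij_betw_imp_inj_on[OF bij]
          inj_on_subset[OF inj_blinfun_inner_right subset_UNIV]])
  moreover have "independent (\<eta> ` {1..7})"
    unfolding img
    by (intro linear_independent_injective_image linear_blinfun_inner_right independent_Basis
        inj_on_subset[OF inj_blinfun_inner_right] subset_UNIV)
  moreover have "span (\<eta> ` {1..7}) = UNIV"
    unfolding img linear_span_image[OF linear_blinfun_inner_right] span_Basis
    by (rule surj_blinfun_inner_right)
  moreover have "flat_g2 = (\<lambda>v. wedge3 (\<eta> 1) (\<eta> 2) (\<eta> 7) v + wedge3 (\<eta> 3) (\<eta> 4) (\<eta> 7) v
               + wedge3 (\<eta> 5) (\<eta> 6) (\<eta> 7) v + wedge3 (\<eta> 1) (\<eta> 3) (\<eta> 5) v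
               - wedge3 (\<eta> 2) (\<eta> 3) (\<eta> 6) v - wedge3 (\<eta> 1) (\<eta> 4) (\<eta> 6) v
               - wedge3 (\<eta> 2) (\<eta> 4) (\<eta> 5) v)"
    by (simp add: fun_eq_iff flat_g2_def wedge_comb_def g2_comb_def \<eta>_def wedge3_inner)
  ultimately show ?thesis
    unfolding g2_form_def by blast
qed

text \<open>
  Both sides are bilinear in \<open>x\<close> and \<open>y\<close>, so expanding the two interior products in the frame reduces the
  identity to \<open>top_coeff_metric\<close>.
\<close>

lemma g2_metric_volume_flat_g2:
  assumes "DIM('v::euclidean_space) = 7"
  shows "g2_metric_volume (flat_g2 :: 'v form) (\<bullet>) std_volume"
  unfolding g2_metric_volume_def
proof (intro conjI allI inner_product_inner volume_form_std_volume)
  fix x y :: 'v and v :: "nat \<Rightarrow> 'v"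
  let ?e = "std_frame :: nat \<Rightarrow> 'v"
  let ?C = "\<lambda>i. wedge_comb ?e (contract_comb i g2_comb)"
  have \<iota>: "interior_product z flat_g2 = (\<lambda>u. \<Sum>i<7. (z \<bullet> ?e i) * ?C i u)" for z
    unfolding flat_g2_def using interior_product_wedge_comb[OF homogeneous_g2_comb] by blast
  have hc: "homogeneous_comb 7 2 (contract_comb i g2_comb)" for i
    by (rule homogeneous_contract_comb[OF homogeneous_g2_comb])
  have hm: "homogeneous_comb 7 4 (mult_comb (contract_comb i g2_comb) (contract_comb j g2_comb))" for i j
    using homogeneous_mult_comb[OF hc hc, of i j] by simp
  have w: "wedge 4 3 (wedge 2 2 (?C i) (?C j)) flat_g2 v = (if i = j then 6 else 0) * std_volume v"
    if "i < 7" "j < 7" for i j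
  proof -
    have "wedge 4 3 (wedge 2 2 (?C i) (?C j)) flat_g2 v =
        wedge_comb ?e (mult_comb (mult_comb (contract_comb i g2_comb) (contract_comb j g2_comb)) g2_comb) v"
      unfolding flat_g2_def by (simp add: wedge_wedge_comb[OF hc hc] wedge_wedge_comb[OF hm homogeneous_g2_comb])
    also have "\<dots> = of_int (if i = j then 6 else 0) * std_volume v"
      using homogeneous_mult_comb[OF hm homogeneous_g2_comb, of i j] assms
      by (subst wedge_comb_std_volume) (simp_all add: top_coeff_metric[OF that])
    finally show ?thesis by simp
  qed
  \<comment> \<open>The last factor is written as a sum with one term, which is the form that \<open>wedge_sum\<close> needs.\<close>
  have "wedge 4 3 (wedge 2 2 (interior_product x flat_g2) (interior_product y flat_g2)) flat_g2 v =
      wedge 4 3 (\<lambda>u. \<Sum>p\<in>{..<7} \<times> {..<7}. ((x \<bullet> ?e (fst p)) * (y \<bullet> ?e (snd p))) *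
         wedge 2 2 (?C (fst p)) (?C (snd p)) u) (\<lambda>u. \<Sum>q\<in>{()}. 1 * flat_g2 u) v"
    unfolding \<iota> by (simp add: wedge_sum[abs_def] sum.cartesian_product case_prod_beta)
  also have "\<dots> = (\<Sum>p\<in>{..<7} \<times> {..<7}. ((x \<bullet> ?e (fst p)) * (y \<bullet> ?e (snd p))) *
      wedge 4 3 (wedge 2 2 (?C (fst p)) (?C (snd p))) flat_g2 v)"
    by (subst wedge_sum) simp
  also have "\<dots> = (\<Sum>p\<in>{..<7} \<times> {..<7}. ((x \<bullet> ?e (fst p)) * (y \<bullet> ?e (snd p))) *
      ((if fst p = snd p then 6 else 0) * std_volume v))"
    by (intro sum.cong refl arg_cong2[where f = "(*)"] w) auto
  also have "\<dots> = (\<Sum>i<7. \<Sum>j<7. (x \<bullet> ?e i) * (y \<bullet> ?e j) * ((if i = j then 6 else 0) * std_volume v))"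
    by (simp add: sum.cartesian_product case_prod_beta)
  also have "\<dots> = (\<Sum>i<7. (x \<bullet> ?e i) * (y \<bullet> ?e i) * (6 * std_volume v))"
  proof (intro sum.cong refl)
    fix i assume i: "i \<in> {..<7::nat}"
    have "(\<Sum>j<7. (x \<bullet> ?e i) * (y \<bullet> ?e j) * ((if i = j then 6 else 0) * std_volume v)) =
        (\<Sum>j<7. if i = j then (x \<bullet> ?e i) * (y \<bullet> ?e i) * (6 * std_volume v) else 0)"
      by (intro sum.cong) auto
    then show "(\<Sum>j<7. (x \<bullet> ?e i) * (y \<bullet> ?e j) * ((if i = j then 6 else 0) * std_volume v)) =
        (x \<bullet> ?e i) * (y \<bullet> ?e i) * (6 * std_volume v)"
      using i by simp
  qed
  also have "\<dots> = 6 * (x \<bullet> y) * std_volume v"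
    unfolding inner_std_frame_expansion[of x y, symmetric] assms
    by (simp add: sum_distrib_left sum_distrib_right mult_ac)
  finally show "6 * (x \<bullet> y) * std_volume v =
      wedge 4 3 (wedge 2 2 (interior_product x flat_g2) (interior_product y flat_g2)) flat_g2 v"
    by (rule sym)
qed

lemma flat_g2_frame_value:
  assumes "DIM('v::euclidean_space) = 7" "I 0 < 7" "I 1 < 7" "I 2 < 7"
  shows "(flat_g2 :: 'v form) (\<lambda>i. std_frame (I i)) = of_int (frame_value3 g2_comb (I 0) (I 1) (I 2))"
proof -
  have e: "(std_frame i :: 'v) \<bullet> std_frame j = of_bool (i = j)" if "i < 7" "j < 7" for i j
    using inner_std_frame[of i j, where 'v = 'v] assms(1) that by simp
  have "flat_wedge [std_frame a, std_frame b, std_frame d] (\<lambda>i. std_frame (I i) :: 'v) = of_int (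
       of_bool (I 0 = a) * of_bool (I 1 = b) * of_bool (I 2 = d)
     + of_bool (I 1 = a) * of_bool (I 2 = b) * of_bool (I 0 = d)
     + of_bool (I 2 = a) * of_bool (I 0 = b) * of_bool (I 1 = d)
     - of_bool (I 0 = a) * of_bool (I 2 = b) * of_bool (I 1 = d)
     - of_bool (I 1 = a) * of_bool (I 0 = b) * of_bool (I 2 = d)
     - of_bool (I 2 = a) * of_bool (I 1 = b) * of_bool (I 0 = d))"
    if "a < 7" "b < 7" "d < 7" for a b d
    unfolding flat_wedge3 e[OF assms(2) that(1)] e[OF assms(2) that(2)] e[OF assms(2) that(3)]
      e[OF assms(3) that(1)] e[OF assms(3) that(2)] e[OF assms(3) that(3)]
      e[OF assms(4) that(1)] e[OF assms(4) that(2)] e[OF assms(4) that(3)]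
    by simp
  then show ?thesis
    by (simp add: flat_g2_def wedge_comb_def g2_comb_def frame_value3_def del: of_bool_eq_iff)
qed

text \<open>
  An arbitrary 3-form \<open>\<alpha>\<close> is expanded into tensors of frame covectors with coefficients its values on
  triples of frame vectors. These are the coefficients that occur in \<open>form_inner\<close>, and the factor \<open>1 / 3!\<close>
  of \<open>form_inner\<close> is the one of \<open>wedge_flat_tensor_flat_wedge\<close>; hence it suffices to compare
  the triples one by one (\<open>top_coeff_hodge\<close>).
\<close>

lemma is_hodge_star_flat_g2:
  assumes "DIM('v::euclidean_space) = 7"
  shows "is_hodge_star (\<bullet>) (std_volume :: 'v form) 3 flat_g2 flat_g2_dual"
proof -
  let ?e = "std_frame :: nat \<Rightarrow> 'v"
  have "wedge 3 4 \<alpha> flat_g2_dual v = form_inner ?e 3 \<alpha> flat_g2 * std_volume v"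
    if \<alpha>: "alternating_form 3 \<alpha>" for \<alpha> v
  proof -
    let ?P = "{..<3::nat} \<rightarrow>\<^sub>E {..<7::nat}"
    let ?l = "\<lambda>I. [I 0, I 1, I 2] :: nat list"
    have "\<alpha> u = (\<Sum>I\<in>?P. \<alpha> (\<lambda>i. ?e (I i)) * flat_tensor (map ?e (?l I)) u)" for u
      using multilinear_form_expansion[of 3 \<alpha> u] \<alpha> assms
      by (simp add: alternating_form_iff numeral_3_eq_3 numeral_2_eq_2 mult_ac)
    then have "\<alpha> = (\<lambda>u. \<Sum>I\<in>?P. \<alpha> (\<lambda>i. ?e (I i)) * flat_tensor (map ?e (?l I)) u)"
      by blast
    \<comment> \<open>Here and below a single form is written as a sum with one term, to match \<open>wedge_sum\<close> and
      \<open>wedge_sum_list\<close>.\<close>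
    then have "wedge 3 4 \<alpha> flat_g2_dual v =
        wedge 3 4 (\<lambda>u. \<Sum>I\<in>?P. \<alpha> (\<lambda>i. ?e (I i)) * flat_tensor (map ?e (?l I)) u)
          (\<lambda>u. \<Sum>q\<in>{()}. 1 * flat_g2_dual u) v"
      by simp
    also have "\<dots> = (\<Sum>I\<in>?P. \<alpha> (\<lambda>i. ?e (I i)) * wedge 3 4 (flat_tensor (map ?e (?l I))) flat_g2_dual v)"
      by (subst wedge_sum) simp
    also have "\<dots> = (\<Sum>I\<in>?P. \<alpha> (\<lambda>i. ?e (I i)) * (flat_g2 (\<lambda>i. ?e (I i)) * std_volume v / 6))"
    proof (intro sum.cong refl arg_cong2[where f = "(*)"])
      fix I assume "I \<in> ?P"
      then have I: "I 0 < 7" "I 1 < 7" "I 2 < 7"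
        by (auto simp: PiE_iff)
      have "wedge 3 4 (flat_tensor (map ?e (?l I))) flat_g2_dual v =
          wedge 3 4 (\<lambda>u. \<Sum>p\<leftarrow>[()]. 1 * flat_tensor (map ?e (?l I)) u)
            (\<lambda>u. \<Sum>q\<leftarrow>g2_dual_comb. of_int (fst q) * flat_wedge (map ?e (snd q)) u) v"
        by (simp add: flat_g2_dual_def wedge_comb_def del: flat_tensor.simps)
      also have "\<dots> = (\<Sum>q\<leftarrow>g2_dual_comb. of_int (fst q) *
          wedge 3 4 (flat_tensor (map ?e (?l I))) (flat_wedge (map ?e (snd q))) v)"
        by (subst wedge_sum_list) simp
      also have "\<dots> = (\<Sum>q\<leftarrow>g2_dual_comb. of_int (fst q) * (flat_wedge (map ?e (?l I @ snd q)) v / 6))"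
        using homogeneous_g2_dual_comb
        by (intro arg_cong[where f = sum_list] map_cong refl arg_cong2[where f = "(*)"],
            subst wedge_flat_tensor_flat_wedge)
          (auto simp: homogeneous_comb_def list_all_iff fact_numeral)
      also have "\<dots> = wedge_comb ?e (mult_comb [(1, ?l I)] g2_dual_comb) v / 6"
        unfolding wedge_comb_def sum_list_mult_comb
        by (simp add: sum_list_sum_nth sum_divide_distrib)
      also have "\<dots> = of_int (top_coeff (mult_comb [(1, ?l I)] g2_dual_comb)) * std_volume v / 6"
      proof -
        have "homogeneous_comb 7 3 [(1, ?l I)]"
          using I by (simp add: homogeneous_comb_def)
        from homogeneous_mult_comb[OF this homogeneous_g2_dual_comb]
        show ?thesis
          using assms by (simp add: wedge_comb_std_volume)
      qed
      finally show "wedge 3 4 (flat_tensor (map ?e (?l I))) flat_g2_dual v =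
          flat_g2 (\<lambda>i. ?e (I i)) * std_volume v / 6"
        by (simp only: top_coeff_hodge[OF I] flat_g2_frame_value[OF assms I])
    qed
    also have "\<dots> = form_inner ?e 3 \<alpha> flat_g2 * std_volume v"
      using assms
      by (simp add: form_inner_def sum_distrib_left sum_distrib_right sum_divide_distrib fact_numeral mult_ac)
    finally show ?thesis .
  qed
  then show ?thesis
    using assms alternating_flat_g2_dual[where 'a = 'v] orthonormal_std_frame[where 'v = 'v]
    unfolding is_hodge_star_def by (intro conjI exI[of _ ?e]) auto
qed

lemma is_g2_dual_flat_g2:
  "DIM('v::euclidean_space) = 7 \<Longrightarrow> is_g2_dual (flat_g2 :: 'v form) flat_g2_dual"
  unfolding is_g2_dual_def
  using g2_metric_volume_flat_g2 is_hodge_star_flat_g2 by blast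

text \<open>
  A form of even degree does not change when all its arguments change sign.
\<close>

lemma flat_g2_dual_minus: "flat_g2_dual (\<lambda>i. - v i) = flat_g2_dual (v :: nat \<Rightarrow> 'v::euclidean_space)"
proof -
  have "flat_tensor w (\<lambda>i. - u i) = (-1) ^ length w * flat_tensor w u" for w :: "'v list" and u
    by (induction w arbitrary: u) auto
  then have "flat_wedge w (\<lambda>i. - v i) = (-1) ^ length w * flat_wedge w v" for w :: "'v list"
    by (simp add: flat_wedge_def alt_sum_def sum_distrib_left mult_ac)
  then show ?thesis
    by (simp add: flat_g2_dual_def wedge_comb_def g2_dual_comb_def)
qed

section \<open>The torus and its charts\<close>

definition torus :: "(complex ^ 'n) set" where
  "torus = {z. \<forall>j. norm (z $ j) = 1}"

definition torus_exp :: "real ^ 'n \<Rightarrow> complex ^ 'n" where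
  "torus_exp x = (\<chi> j. cis (x $ j))"

text \<open>
  The inverse of \<open>torus_exp\<close> on the open cube of half side \<open>\<pi>\<close> around \<open>\<theta>\<close>: the domain leaves out the
  points with some coordinate opposite to that of \<open>torus_exp \<theta>\<close>, where \<open>Arg\<close> jumps.
\<close>

definition torus_chart :: "real ^ 'n \<Rightarrow> (complex ^ 'n, real ^ 'n) chart" where
  "torus_chart \<theta> =
     ({z \<in> torus. \<forall>j. z $ j * cis (- \<theta> $ j) \<notin> \<real>\<^sub>\<le>\<^sub>0}, \<lambda>z. \<chi> j. \<theta> $ j + Arg (z $ j * cis (- \<theta> $ j)))"

definition torus_atlas :: "(complex ^ 'n, real ^ 'n) chart set" where
  "torus_atlas = range torus_chart"

abbreviation torus_topology :: "(complex ^ 'n) topology" where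
  "torus_topology \<equiv> top_of_set torus"

lemma torus_exp_in_torus [simp]: "torus_exp x \<in> torus"
  by (simp add: torus_def torus_exp_def)

lemma torus_eq_range: "torus = range torus_exp"
proof (intro equalityI subsetI)
  fix z :: "complex ^ 'n" assume "z \<in> torus"
  then have "norm (z $ j) = 1" for j by (simp add: torus_def)
  then have "z = torus_exp (\<chi> j. Arg (z $ j))"
    by (simp add: torus_exp_def vec_eq_iff cis_Arg_unique complex_eq_iff cis_Arg sgn_div_norm)
       (metis cis_Arg div_by_1 norm_zero of_real_1 sgn_eq zero_neq_one cis.sel)
  then show "z \<in> range torus_exp" by blast
qed auto

lemma continuous_on_torus_exp: "continuous_on S torus_exp"
  unfolding torus_exp_def by (intro continuous_intros)

text \<open>
  Points with the same image differ by \<open>2 \<pi>\<close> times an integer vector, and the bound excludes all but \<open>0\<close>.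
\<close>

lemma torus_exp_inj_locally:
  assumes "torus_exp x = torus_exp y" "\<And>j. \<bar>x $ j - y $ j\<bar> < 2 * pi"
  shows "x = y"
proof -
  have "x $ j = y $ j" for j
  proof -
    have "cis (x $ j) = cis (y $ j)"
      using assms(1) by (simp add: torus_exp_def vec_eq_iff)
    then have "sin (x $ j) = sin (y $ j) \<and> cos (x $ j) = cos (y $ j)"
      by (simp add: complex_eq_iff)
    then obtain m :: int where m: "x $ j = y $ j + 2 * pi * m"
      by (auto simp: sin_cos_eq_iff)
    then have "2 * pi * \<bar>real_of_int m\<bar> < 2 * pi * 1"
      using assms(2)[of j] by (simp add: abs_mult)
    then have "m = 0"
      by (subst (asm) mult_less_cancel_left_pos) auto
    then show ?thesis using m by simp
  qed
  then show ?thesis by (simp add: vec_eq_iff)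
qed

lemma torus_exp_shift: "torus_exp x $ j * cis (- \<theta> $ j) = cis (x $ j - \<theta> $ j)"
  by (simp add: torus_exp_def cis_mult)

lemma cis_not_nonpos:
  assumes "\<bar>t\<bar> < pi"
  shows "cis t \<notin> \<real>\<^sub>\<le>\<^sub>0"
proof
  assume "cis t \<in> \<real>\<^sub>\<le>\<^sub>0"
  then have "Re (cis t) \<le> 0" "Im (cis t) = 0"
    by (auto simp: complex_nonpos_Reals_iff)
  moreover have "cis t \<noteq> 0" by simp
  ultimately have "Re (cis t) < 0 \<and> Im (cis t) = 0"
    by (metis complex_eq_iff less_eq_real_def zero_complex.sel)
  then have "Arg (cis t) = pi"
    using Arg_eq_pi by blast
  then show False
    using assms Arg_cis[of t] by (auto simp: abs_less_iff)
qed

lemma torus_chart_dom_image: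
  "chart_dom (torus_chart \<theta>) = torus_exp ` {x. \<forall>j. \<bar>x $ j - \<theta> $ j\<bar> < pi}"
  and torus_chart_map_exp:
  "(\<forall>j. \<bar>x $ j - \<theta> $ j\<bar> < pi) \<Longrightarrow> chart_map (torus_chart \<theta>) (torus_exp x) = x"
proof -
  show "chart_map (torus_chart \<theta>) (torus_exp x) = x" if "\<forall>j. \<bar>x $ j - \<theta> $ j\<bar> < pi" for x
  proof -
    have "Arg (cis (x $ j - \<theta> $ j)) = x $ j - \<theta> $ j" for j
    proof (rule Arg_cis)
      have "\<bar>x $ j - \<theta> $ j\<bar> < pi" using that by blast
      then show "x $ j - \<theta> $ j \<in> {- pi<..pi}" by auto
    qed
    then show ?thesis
      unfolding torus_chart_def snd_conv torus_exp_shift by (simp add: vec_eq_iff)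
  qed
  show "chart_dom (torus_chart \<theta>) = torus_exp ` {x. \<forall>j. \<bar>x $ j - \<theta> $ j\<bar> < pi}"
  proof (intro equalityI subsetI)
    fix z assume "z \<in> chart_dom (torus_chart \<theta>)"
    then have z: "z \<in> torus" and nn: "\<And>j. z $ j * cis (- \<theta> $ j) \<notin> \<real>\<^sub>\<le>\<^sub>0"
      by (auto simp: torus_chart_def)
    define x :: "real ^ 'a" where "x = (\<chi> j. \<theta> $ j + Arg (z $ j * cis (- \<theta> $ j)))"
    have "\<bar>x $ j - \<theta> $ j\<bar> < pi" for j
    proof -
      have "Arg (z $ j * cis (- \<theta> $ j)) \<noteq> pi"
        using nn[of j] by (auto simp: Arg_eq_pi complex_nonpos_Reals_iff)
      then show ?thesis
        using mpi_less_Arg[of "z $ j * cis (- \<theta> $ j)"] Arg_le_pi[of "z $ j * cis (- \<theta> $ j)"]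
        by (simp add: x_def abs_less_iff)
    qed
    moreover have "cis (x $ j) = z $ j" for j
    proof -
      let ?w = "z $ j * cis (- \<theta> $ j)"
      have "norm ?w = 1"
        using z by (simp add: norm_mult torus_def)
      then have "cis (Arg ?w) = ?w"
        by (subst cis_Arg) (auto simp: sgn_eq)
      then have "cis (x $ j) = cis (\<theta> $ j) * ?w"
        by (simp add: x_def flip: cis_mult)
      also have "\<dots> = z $ j * cis (\<theta> $ j + - \<theta> $ j)"
        by (simp only: flip: cis_mult) (simp add: mult_ac)
      finally show ?thesis by simp
    qed
    ultimately show "z \<in> torus_exp ` {x. \<forall>j. \<bar>x $ j - \<theta> $ j\<bar> < pi}"
      by (intro image_eqI[of _ _ x]) (auto simp: torus_exp_def vec_eq_iff)
  next
    fix z assume "z \<in> torus_exp ` {x. \<forall>j. \<bar>x $ j - \<theta> $ j\<bar> < pi}"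
    then obtain x where "z = torus_exp x" "\<And>j. \<bar>x $ j - \<theta> $ j\<bar> < pi" by auto
    then show "z \<in> chart_dom (torus_chart \<theta>)"
      unfolding torus_chart_def fst_conv by (auto simp: torus_exp_shift cis_not_nonpos)
  qed
qed

lemma chart_image_torus_chart: "chart_image (torus_chart \<theta>) = {x. \<forall>j. \<bar>x $ j - \<theta> $ j\<bar> < pi}"
  unfolding chart_image_def torus_chart_dom_image image_image
  by (auto simp: torus_chart_map_exp image_iff)

lemma torus_chart_exp:
  assumes "x \<in> chart_image (torus_chart \<theta>)"
  shows "torus_exp x \<in> chart_dom (torus_chart \<theta>)" "chart_map (torus_chart \<theta>) (torus_exp x) = x"
  using assms by (auto simp: chart_image_torus_chart torus_chart_dom_image torus_chart_map_exp)

lemma torus_exp_chart_map: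
  assumes "z \<in> chart_dom (torus_chart \<theta>)"
  shows "torus_exp (chart_map (torus_chart \<theta>) z) = z"
  using assms unfolding torus_chart_dom_image by (auto simp: torus_chart_map_exp)

lemma chart_inv_torus_chart:
  assumes "x \<in> chart_image (torus_chart \<theta>)"
  shows "chart_inv (torus_chart \<theta>) x = torus_exp x"
proof -
  have "inj_on (chart_map (torus_chart \<theta>)) (chart_dom (torus_chart \<theta>))"
    by (rule inj_on_inverseI[of _ torus_exp]) (rule torus_exp_chart_map)
  then show ?thesis
    unfolding chart_inv_def using torus_chart_exp[OF assms] by (metis inv_into_f_f)
qed

lemma open_chart_image_torus: "open (chart_image (torus_chart \<theta>))"
proof -
  have "chart_image (torus_chart \<theta>) = box (\<chi> j. \<theta> $ j - pi) (\<chi> j. \<theta> $ j + pi)"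
    unfolding chart_image_torus_chart by (auto simp: mem_box_cart abs_less_iff algebra_simps)
  then show ?thesis by (simp add: open_box)
qed

lemma torus_chart_dom_open:
  obtains U where "open U" "chart_dom (torus_chart \<theta>) = torus \<inter> U"
proof
  show "open (\<Inter>j. (\<lambda>z :: complex ^ 'a. z $ j * cis (- \<theta> $ j)) -` (- \<real>\<^sub>\<le>\<^sub>0))"
    by (intro open_INT finite_UNIV ballI open_vimage continuous_intros open_Compl
        closed_nonpos_Reals_complex) auto
  show "chart_dom (torus_chart \<theta>) =
      torus \<inter> (\<Inter>j. (\<lambda>z :: complex ^ 'a. z $ j * cis (- \<theta> $ j)) -` (- \<real>\<^sub>\<le>\<^sub>0))"
    by (auto simp: torus_chart_def)
qed

lemma continuous_on_torus_chart_map: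
  "continuous_on (chart_dom (torus_chart \<theta>)) (chart_map (torus_chart \<theta>))"
  unfolding torus_chart_def fst_conv snd_conv
  by (intro continuous_intros) auto

lemma is_chart_torus_chart: "is_chart torus_topology (torus_chart \<theta>)"
proof -
  let ?D = "chart_dom (torus_chart \<theta>)" and ?I = "chart_image (torus_chart \<theta>)"
  have "?D \<subseteq> torus" by (auto simp: torus_chart_def)
  then have sub: "subtopology torus_topology ?D = top_of_set ?D"
    by (simp add: subtopology_subtopology Int_absorb1)
  have "homeomorphic_maps (top_of_set ?D) (top_of_set ?I) (chart_map (torus_chart \<theta>)) torus_exp"
    unfolding homeomorphic_maps_def
    by (auto simp: continuous_on_torus_chart_map continuous_on_torus_exp torus_chart_exp
        torus_exp_chart_map chart_image_def)
  moreover obtain U where "open U" "?D = torus \<inter> U"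
    by (rule torus_chart_dom_open)
  ultimately show ?thesis
    unfolding is_chart_def sub
    by (auto simp: open_chart_image_torus homeomorphic_map_maps openin_open)
qed

lemma torus_chart_self: "torus_exp x \<in> chart_dom (torus_chart x)"
  unfolding torus_chart_dom_image by auto

lemma chart_at_torus:
  assumes "z \<in> torus"
  shows "chart_at torus_atlas z \<in> torus_atlas" "z \<in> chart_dom (chart_at torus_atlas z)"
proof -
  have "\<exists>c. c \<in> torus_atlas \<and> z \<in> chart_dom c"
    using assms torus_chart_self unfolding torus_eq_range torus_atlas_def by blast
  then have "chart_at torus_atlas z \<in> torus_atlas \<and> z \<in> chart_dom (chart_at torus_atlas z)"
    unfolding chart_at_def by (rule someI_ex)
  then show "chart_at torus_atlas z \<in> torus_atlas" "z \<in> chart_dom (chart_at torus_atlas z)"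
    by blast+
qed

section \<open>Maps of the torus with an affine lift\<close>

text \<open>
  A function whose derivative is the same at all points of \<open>S\<close> has second derivative \<open>0\<close> there, so the
  induction on the order of differentiability applies to the derivative again.
\<close>

lemma smooth_on_constant_derivative:
  assumes "open S" "\<And>x. x \<in> S \<Longrightarrow> (f has_derivative D) (at x)"
  shows "smooth_on S f"
proof -
  have "Ck_on k S f" for k
    using assms(2)
  proof (induction k arbitrary: f D)
    case 0
    then show ?case
      by (auto intro!: continuous_at_imp_continuous_on has_derivative_continuous)
  next
    case (Suc k)
    have "((\<lambda>y. frechet_derivative f (at y) v) has_derivative (\<lambda>_. 0)) (at x)" if "x \<in> S" for x v
    proof (rule has_derivative_transform_within_open[OF has_derivative_const[of "D v"] assms(1) that])
      fix y assume "y \<in> S"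
      then show "D v = frechet_derivative f (at y) v"
        using Suc.prems frechet_derivative_at by metis
    qed
    then have "Ck_on k S (\<lambda>y. frechet_derivative f (at y) v)" for v
      by (rule Suc.IH)
    moreover have "f differentiable at x" if "x \<in> S" for x
      using Suc.prems[OF that] by (rule differentiableI)
    ultimately show ?case by simp
  qed
  then show ?thesis
    by (simp add: smooth_on_def)
qed

text \<open>
  The continuous function \<open>r\<close>, given by \<open>r y = h y - (s y + b)\<close>, takes values in the lattice of vectors
  that \<open>torus_exp\<close> maps to the identity. The lattice is discrete, so \<open>r\<close> is locally constant and \<open>h\<close> is
  locally an affine map with linear part \<open>s\<close>.
\<close>

lemma lifted_affine_has_derivative:
  fixes h :: "real ^ 'n \<Rightarrow> real ^ 'n"
  assumes "open S" "continuous_on S h" "x \<in> S"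
    and lift: "\<And>y. y \<in> S \<Longrightarrow> torus_exp (h y) = torus_exp (s *\<^sub>R y + b)"
  shows "(h has_derivative (\<lambda>v. s *\<^sub>R v)) (at x)"
proof -
  define r where "r y = h y - (s *\<^sub>R y + b)" for y
  have "continuous_on S r"
    unfolding r_def using assms(2) by (intro continuous_intros)
  then have "isCont r x"
    using assms by (simp add: continuous_on_eq_continuous_at)
  then obtain d where d: "d > 0" "\<And>y. dist y x < d \<Longrightarrow> dist (r y) (r x) < 2 * pi"
    unfolding continuous_at_eps_delta using pi_gt_zero by (metis dist_commute zero_less_mult_iff zero_less_numeral)
  have r1: "torus_exp (r y) = torus_exp 0" if "y \<in> S" for y
  proof -
    have "cis (h y $ j) = cis ((s *\<^sub>R y + b) $ j)" for j
      using lift[OF that] by (simp add: torus_exp_def vec_eq_iff)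
    then have "cis (r y $ j) = 1" for j
      unfolding r_def vector_minus_component cis_divide[symmetric] by simp
    then show ?thesis
      by (simp add: torus_exp_def vec_eq_iff)
  qed
  have eq: "h y = s *\<^sub>R y + b + r x" if "y \<in> S \<inter> ball x d" for y
  proof -
    have "r y = r x"
    proof (rule torus_exp_inj_locally)
      show "torus_exp (r y) = torus_exp (r x)"
        using r1 that assms(3) by auto
      fix j
      have "\<bar>(r y - r x) $ j\<bar> \<le> norm (r y - r x)"
        by (rule component_le_norm_cart)
      also have "\<dots> < 2 * pi"
        using d(2)[of y] that by (auto simp: dist_norm dist_commute norm_minus_commute)
      finally show "\<bar>r y $ j - r x $ j\<bar> < 2 * pi" by simp
    qed
    then show ?thesis by (simp add: r_def algebra_simps)
  qed
  have "((\<lambda>y. s *\<^sub>R y + b + r x) has_derivative (\<lambda>v. s *\<^sub>R v)) (at x)"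
    by (auto intro!: derivative_eq_intros)
  then show ?thesis
    by (rule has_derivative_transform_within_open[of _ _ _ _ "S \<inter> ball x d"])
      (use assms d eq in auto)
qed

text \<open>
  The identity, the translations and the inversion are all instances, with \<open>s = 1\<close> or \<open>s = - 1\<close>.
\<close>

context
  fixes f :: "complex ^ 'n \<Rightarrow> complex ^ 'n" and s :: real and b :: "real ^ 'n"
  assumes lift: "\<And>x. f (torus_exp x) = torus_exp (s *\<^sub>R x + b)"
begin

lemma lifted_affine_domain:
  assumes "c \<in> torus_atlas" "d \<in> torus_atlas"
  shows "chart_map c ` {p \<in> chart_dom c. f p \<in> chart_dom d} =
    {x \<in> chart_image c. torus_exp (s *\<^sub>R x + b) \<in> chart_dom d}"
proof -
  obtain \<theta> where c: "c = torus_chart \<theta>"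
    using assms by (auto simp: torus_atlas_def)
  show ?thesis
  proof (intro equalityI subsetI)
    fix x assume "x \<in> chart_map c ` {p \<in> chart_dom c. f p \<in> chart_dom d}"
    then obtain p where p: "p \<in> chart_dom c" "f p \<in> chart_dom d" "x = chart_map c p" by auto
    then have "torus_exp x = p"
      unfolding c by (simp add: torus_exp_chart_map)
    then show "x \<in> {x \<in> chart_image c. torus_exp (s *\<^sub>R x + b) \<in> chart_dom d}"
      using p by (auto simp: chart_image_def simp flip: lift)
  next
    fix x assume x: "x \<in> {x \<in> chart_image c. torus_exp (s *\<^sub>R x + b) \<in> chart_dom d}"
    then show "x \<in> chart_map c ` {p \<in> chart_dom c. f p \<in> chart_dom d}"
      using torus_chart_exp[of x \<theta>] unfolding c by (intro image_eqI[of _ _ "torus_exp x"]) (auto simp: lift)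
  qed
qed

lemma open_lifted_affine_domain:
  assumes "c \<in> torus_atlas" "d \<in> torus_atlas"
  shows "open (chart_map c ` {p \<in> chart_dom c. f p \<in> chart_dom d})"
proof -
  obtain \<theta> \<theta>' where c: "c = torus_chart \<theta>" and d: "d = torus_chart \<theta>'"
    using assms by (auto simp: torus_atlas_def)
  obtain U where U: "open U" "chart_dom d = torus \<inter> U"
    unfolding d by (rule torus_chart_dom_open)
  have "chart_map c ` {p \<in> chart_dom c. f p \<in> chart_dom d} =
      chart_image c \<inter> (\<lambda>x. torus_exp (s *\<^sub>R x + b)) -` U"
    using U(2) unfolding lifted_affine_domain[OF assms] by auto
  moreover have "continuous_on UNIV (\<lambda>x. torus_exp (s *\<^sub>R x + b))"
    by (rule continuous_on_compose2[OF continuous_on_torus_exp[of UNIV]]) (auto intro!: continuous_intros)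
  ultimately show ?thesis
    using open_chart_image_torus[of \<theta>] open_vimage[OF U(1)] c by (auto intro!: open_Int)
qed

lemma lifted_affine_chart_derivative:
  assumes "c \<in> torus_atlas" "d \<in> torus_atlas"
    and "x \<in> chart_map c ` {p \<in> chart_dom c. f p \<in> chart_dom d}"
  shows "((\<lambda>x. chart_map d (f (chart_inv c x))) has_derivative (\<lambda>v. s *\<^sub>R v)) (at x)"
proof (rule lifted_affine_has_derivative[OF open_lifted_affine_domain[OF assms(1,2)] _ assms(3)])
  obtain \<theta> \<theta>' where c: "c = torus_chart \<theta>" and d: "d = torus_chart \<theta>'"
    using assms by (auto simp: torus_atlas_def)
  let ?S = "chart_map c ` {p \<in> chart_dom c. f p \<in> chart_dom d}"
  note S = lifted_affine_domain[OF assms(1,2)]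
  have h: "chart_map d (f (chart_inv c y)) = chart_map d (torus_exp (s *\<^sub>R y + b))" if "y \<in> ?S" for y
    using that chart_inv_torus_chart[of y \<theta>] unfolding S unfolding c by (simp add: lift)
  have "continuous_on ?S (\<lambda>y. chart_map d (torus_exp (s *\<^sub>R y + b)))"
    unfolding d
    by (rule continuous_on_compose2[OF continuous_on_torus_chart_map
          continuous_on_compose2[OF continuous_on_torus_exp[of UNIV]]])
      (auto intro!: continuous_intros simp: S[unfolded d])
  then show "continuous_on ?S (\<lambda>x. chart_map d (f (chart_inv c x)))"
    using h by (simp cong: continuous_on_cong)
  show "torus_exp (chart_map d (f (chart_inv c y))) = torus_exp (s *\<^sub>R y + b)" if "y \<in> ?S" for y
    using h[OF that] that torus_exp_chart_map[of _ \<theta>'] unfolding S unfolding d by simp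
qed

lemma lifted_affine_smooth_map:
  assumes "continuous_map torus_topology torus_topology f"
  shows "smooth_map torus_topology torus_atlas torus_topology torus_atlas f"
  unfolding smooth_map_def
  by (intro conjI ballI assms smooth_on_constant_derivative[where D = "\<lambda>v. s *\<^sub>R v"]
      open_lifted_affine_domain lifted_affine_chart_derivative) auto

lemma lifted_affine_tangent_map:
  assumes "p \<in> torus"
  shows "tangent_map torus_atlas torus_atlas f p = (\<lambda>v. s *\<^sub>R v)"
proof -
  have "f p \<in> torus"
    using assms unfolding torus_eq_range using lift by auto
  then show ?thesis
    unfolding tangent_map_def using chart_at_torus assms
    by (intro frechet_derivative_at[symmetric] lifted_affine_chart_derivative) auto
qed

end

text \<open>
  The transition functions are the coordinate expressions of the identity, whose lift is affine.
\<close>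

lemma smooth_manifold_torus: "smooth_manifold (torus_topology :: (complex ^ 'n) topology) torus_atlas"
proof -
  have "smooth_on (chart_map c ` (chart_dom c \<inter> chart_dom d)) (\<lambda>x. chart_map d (chart_inv c x))"
    if "c \<in> torus_atlas" "d \<in> torus_atlas" for c d :: "(complex ^ 'n, real ^ 'n) chart"
  proof -
    have "smooth_map torus_topology torus_atlas torus_topology torus_atlas (\<lambda>p :: complex ^ 'n. p)"
      by (rule lifted_affine_smooth_map[where s = 1 and b = 0]) auto
    with that show ?thesis
      unfolding smooth_map_def Int_def by blast
  qed
  moreover have "(\<Union>c\<in>torus_atlas. chart_dom c) = (torus :: (complex ^ 'n) set)"
    using chart_at_torus by (force simp: torus_atlas_def torus_chart_def)
  moreover have "second_countable (euclidean :: (complex ^ 'n) topology)"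
  proof -
    obtain B :: "(complex ^ 'n) set set" where "countable B" "topological_basis B"
      using ex_countable_basis by blast
    then show ?thesis
      unfolding second_countable_def by (intro exI[of _ B])
        (auto simp: topological_basis_def elim: topological_basisE[OF \<open>topological_basis B\<close>] intro: topological_basis_open)
  qed
  ultimately show ?thesis
    unfolding smooth_manifold_def smooth_atlas_def
    by (auto simp: second_countable_subtopology Hausdorff_space_subtopology torus_atlas_def is_chart_torus_chart)
qed

lemma compact_torus: "compact (torus :: (complex ^ 'n) set)"
proof -
  have "(torus :: (complex ^ 'n) set) = torus_exp ` cbox (\<chi> j. - pi) (\<chi> j. pi)"
  proof (intro equalityI subsetI)
    fix z :: "complex ^ 'n" assume "z \<in> torus"
    then obtain y where y: "z = torus_exp y" by (auto simp: torus_eq_range)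
    have "z = torus_exp (\<chi> j. Arg (cis (y $ j)))"
      unfolding y by (simp add: torus_exp_def vec_eq_iff cis_Arg sgn_eq)
    then show "z \<in> torus_exp ` cbox (\<chi> j. - pi) (\<chi> j. pi)"
      by (intro image_eqI) (auto simp: mem_box_cart Arg_le_pi less_imp_le[OF mpi_less_Arg])
  qed auto
  then show ?thesis
    using compact_continuous_image[OF continuous_on_torus_exp compact_cbox] by metis
qed

section \<open>Forms with constant coefficients\<close>

text \<open>
  In the preferred charts a constant form looks the same at every point. It does so in every chart,
  because the transition functions have derivative \<open>id\<close>.
\<close>

lemma form_in_chart_constant:
  assumes "c \<in> torus_atlas" "x \<in> chart_image c"
  shows "form_in_chart torus_atlas (\<lambda>_. \<omega>) c x = \<omega>"
proof -
  obtain \<theta> where c: "c = torus_chart \<theta>"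
    using assms by (auto simp: torus_atlas_def)
  let ?p = "torus_exp x"
  let ?d = "chart_at torus_atlas ?p"
  have p: "chart_inv c x = ?p" "?p \<in> chart_dom c" "chart_map c ?p = x"
    using chart_inv_torus_chart torus_chart_exp assms(2) unfolding c by auto
  have "((\<lambda>y. chart_map ?d (chart_inv c y)) has_derivative (\<lambda>v. 1 *\<^sub>R v)) (at x)"
    using chart_at_torus[of ?p] assms(1) p
    by (intro lifted_affine_chart_derivative[where f = "\<lambda>p. p" and s = 1 and b = 0]) (auto intro!: image_eqI[of _ _ ?p])
  then have "frechet_derivative (\<lambda>y. chart_map ?d (chart_inv c y)) (at x) = (\<lambda>v. v)"
    using frechet_derivative_at by fastforce
  then show ?thesis
    by (simp add: form_in_chart_def p Let_def)
qed

lemma form_in_chart_constant_derivative: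
  assumes "c \<in> torus_atlas" "x \<in> chart_image c"
  shows "((\<lambda>y. form_in_chart torus_atlas (\<lambda>_. \<omega>) c y v) has_derivative (\<lambda>_. 0)) (at x)"
proof -
  have "open (chart_image c)"
    using assms(1) open_chart_image_torus by (auto simp: torus_atlas_def)
  then show ?thesis
    by (rule has_derivative_transform_within_open[OF has_derivative_const[of "\<omega> v"] _ assms(2)])
      (simp add: form_in_chart_constant assms(1))
qed

lemma differential_form_constant:
  assumes "alternating_form k \<omega>"
  shows "differential_form torus_topology torus_atlas k (\<lambda>_. \<omega>)"
  unfolding differential_form_def
proof (intro conjI ballI allI)
  fix c :: "(complex ^ 'a, real ^ 'a) chart" and v assume c: "c \<in> torus_atlas"
  then have "open (chart_image c)"
    using open_chart_image_torus by (auto simp: torus_atlas_def)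
  then show "smooth_on (chart_image c) (\<lambda>x. form_in_chart torus_atlas (\<lambda>_. \<omega>) c x v)"
    using form_in_chart_constant_derivative[OF c] by (rule smooth_on_constant_derivative)
qed (rule assms)

lemma closed_form_constant: "closed_form torus_topology torus_atlas k (\<lambda>_. \<omega>)"
proof -
  have "frechet_derivative (\<lambda>y. form_in_chart torus_atlas (\<lambda>_. \<omega>) (chart_at torus_atlas p) y w)
      (at (chart_map (chart_at torus_atlas p) p)) = (\<lambda>_. 0)" if "p \<in> torus" for p w
    using chart_at_torus[OF that]
    by (intro frechet_derivative_at[symmetric] form_in_chart_constant_derivative)
      (auto simp: chart_image_def)
  then show ?thesis
    by (simp add: closed_form_def ext_deriv_def ext_deriv_local_def)
qed

section \<open>Translations and the inversion\<close>

text \<open>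
  The map with lift \<open>x \<mapsto> s x + b\<close> for \<open>s = 1\<close> or \<open>s = - 1\<close>; the second case uses that complex conjugation
  is inversion on the unit circle. It is restricted to the torus because the elements of \<open>Bij\<close>
  are extensional.
\<close>

definition torus_affine :: "real \<Rightarrow> real ^ 'n \<Rightarrow> complex ^ 'n \<Rightarrow> complex ^ 'n" where
  "torus_affine s b =
     (\<lambda>z\<in>torus. \<chi> j. cis (b $ j) * (if s = 1 then z $ j else cnj (z $ j)))"

lemma torus_affine_exp:
  assumes "s = 1 \<or> s = -1"
  shows "torus_affine s b (torus_exp x) = torus_exp (s *\<^sub>R x + b)"
  using assms by (auto simp: torus_affine_def torus_exp_def vec_eq_iff torus_def cis_mult cis_cnj add.commute)

lemma continuous_map_torus_affine:
  assumes "s = 1 \<or> s = -1"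
  shows "continuous_map torus_topology torus_topology (torus_affine s b)"
proof -
  have "continuous_on torus (\<lambda>z. \<chi> j. cis (b $ j) * (if s = 1 then z $ j else cnj (z $ j)))"
    by (cases "s = 1") (auto intro!: continuous_intros)
  then have "continuous_on torus (torus_affine s b)"
    by (simp add: torus_affine_def cong: continuous_on_cong)
  moreover have "torus_affine s b ` torus \<subseteq> torus"
    using torus_affine_exp[OF assms] by (auto simp: torus_eq_range)
  ultimately show ?thesis
    by auto
qed

lemma torus_affine_inverse:
  assumes "s = 1 \<or> s = -1" "z \<in> torus"
  shows "torus_affine s b (torus_affine s (- (s *\<^sub>R b)) z) = z"
    "torus_affine s (- (s *\<^sub>R b)) (torus_affine s b z) = z"
proof -
  obtain x where "z = torus_exp x"
    using assms(2) by (auto simp: torus_eq_range)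
  then show "torus_affine s b (torus_affine s (- (s *\<^sub>R b)) z) = z"
    "torus_affine s (- (s *\<^sub>R b)) (torus_affine s b z) = z"
    using assms(1) by (auto simp: torus_affine_exp algebra_simps)
qed

lemma torus_affine_mem_Diff:
  assumes "s = 1 \<or> s = -1"
  shows "torus_affine s b \<in> carrier (Diff torus_topology torus_atlas)"
proof -
  let ?f = "torus_affine s b" and ?g = "torus_affine s (- (s *\<^sub>R b))"
  note cont = continuous_map_torus_affine[OF assms]
  have mem: "torus_affine s c z \<in> torus" if "z \<in> torus" for c z
    using torus_affine_exp[OF assms] that by (auto simp: torus_eq_range)
  have bij: "bij_betw ?f torus torus"
    by (rule bij_betw_byWitness[where f' = ?g]) (use torus_affine_inverse[OF assms] mem in auto)
  have inv: "inv_into torus ?f z = ?g z" if "z \<in> torus" for z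
  proof -
    have "?f (?g z) = z" "?g z \<in> torus"
      using torus_affine_inverse[OF assms that] mem that by auto
    then show ?thesis
      using bij by (metis bij_betw_def inv_into_f_f)
  qed
  have "smooth_map torus_topology torus_atlas torus_topology torus_atlas ?f"
    using torus_affine_exp[OF assms] cont by (rule lifted_affine_smooth_map)
  moreover have "smooth_map torus_topology torus_atlas torus_topology torus_atlas (inv_into torus ?f)"
  proof (rule lifted_affine_smooth_map)
    show "inv_into torus ?f (torus_exp x) = torus_exp (s *\<^sub>R x + - (s *\<^sub>R b))" for x
      by (simp only: inv torus_exp_in_torus torus_affine_exp[OF assms])
    show "continuous_map torus_topology torus_topology (inv_into torus ?f)"
      by (rule continuous_map_eq[OF cont]) (simp add: inv)
  qed
  ultimately show ?thesis
    using bij by (simp add: Diff_def Bij_def torus_affine_def)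
qed

text \<open>
  At the point \<open>torus_exp 0\<close> the two compositions give the points with all coordinates \<open>- i\<close> and \<open>i\<close>.
\<close>

lemma torus_affine_not_commute:
  fixes b :: "real ^ 'n"
  assumes "b = (\<chi> j. pi / 2)"
  shows "compose torus (torus_affine (-1) 0) (torus_affine 1 b) \<noteq>
    compose torus (torus_affine 1 b) (torus_affine (-1) 0)"
proof
  assume eq: "compose torus (torus_affine (-1) 0) (torus_affine 1 b) =
      compose torus (torus_affine 1 b) (torus_affine (-1) 0)"
  from fun_cong[OF this, of "torus_exp 0"] have "torus_exp (- b) = torus_exp b"
    by (simp add: compose_def torus_affine_exp)
  then have "cis (- (pi / 2)) = cis (pi / 2)"
    by (simp add: assms torus_exp_def vec_eq_iff)
  then show False
    by (simp add: complex_eq_iff)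
qed


section \<open>A compact coclosed G2-structure with a non-abelian automorphism group\<close>

theorem theorem3p14:
  shows "\<exists>(X :: (complex ^ 7) topology) (A :: (complex ^ 7, real ^ 7) chart set)
            (\<phi> :: complex ^ 7 \<Rightarrow> (real ^ 7) form) (\<psi> :: complex ^ 7 \<Rightarrow> (real ^ 7) form).
           smooth_manifold X A \<and> compact_space X \<and>
           coclosed_g2_structure X A \<phi> \<psi> \<and>
           \<not> (\<forall>f \<in> carrier (Diff_stabilizer X A \<psi>). \<forall>g \<in> carrier (Diff_stabilizer X A \<psi>).
                f \<otimes>\<^bsub>Diff_stabilizer X A \<psi>\<^esub> g = g \<otimes>\<^bsub>Diff_stabilizer X A \<psi>\<^esub> f)"
proof -
  let ?X = "torus_topology :: (complex ^ 7) topology"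
  let ?A = "torus_atlas :: (complex ^ 7, real ^ 7) chart set"
  let ?\<phi> = "\<lambda>_ :: complex ^ 7. flat_g2 :: (real ^ 7) form"
  let ?\<psi> = "\<lambda>_ :: complex ^ 7. flat_g2_dual :: (real ^ 7) form"
  let ?G = "Diff_stabilizer ?X ?A ?\<psi>"
  have dim: "DIM(real ^ 7) = 7" by simp
  have "coclosed_g2_structure ?X ?A ?\<phi> ?\<psi>"
    unfolding coclosed_g2_structure_def g2_structure_def Omega4_plus_def
    using differential_form_constant[OF alternating_flat_g2]
      differential_form_constant[OF alternating_flat_g2_dual]
      g2_form_flat_g2[OF dim] is_g2_dual_flat_g2[OF dim] closed_form_constant
    by blast
  moreover have "compact_space ?X"
    by (simp add: compact_space_subtopology compact_torus)
  moreover have mem: "torus_affine s b \<in> carrier ?G" if s: "s = 1 \<or> s = -1" for s b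
  proof -
    have "pullback_form ?A ?A (torus_affine s b) ?\<psi> p = ?\<psi> p" if "p \<in> torus" for p
      using s lifted_affine_tangent_map[OF torus_affine_exp[OF s] that]
      by (auto simp: pullback_form_def flat_g2_dual_minus)
    then show ?thesis
      using torus_affine_mem_Diff[OF s] by (simp add: Diff_stabilizer_def)
  qed
  moreover define b :: "real ^ 7" where "b = (\<chi> j. pi / 2)"
  have "torus_affine (-1) 0 \<otimes>\<^bsub>?G\<^esub> torus_affine 1 b \<noteq> torus_affine 1 b \<otimes>\<^bsub>?G\<^esub> torus_affine (-1) 0"
  proof -
    have "torus_affine s c \<in> Bij (torus :: (complex ^ 7) set)" if "s = 1 \<or> s = -1" for s c
      using torus_affine_mem_Diff[OF that, of c] by (simp add: Diff_def)
    then show ?thesis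
      using torus_affine_not_commute[OF b_def]
      by (simp add: Diff_stabilizer_def Diff_def BijGroup_def)
  qed
  ultimately show ?thesis
    using smooth_manifold_torus by blast
qed

end
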